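(* Let $\alpha>1$ and let $P\ll Q$ be probability measures on $\mathcal Z$. The index $K$ produced by PPR with parameter $\alpha$, proposal $Q$ and target $P$ satisfies $$\mathbb E[\log K]\le D(P\Vert Q)+\inf_{\eta\in(0,1]\cap(0,\alpha-1)}\frac1\eta\log\left(\frac{\Gamma\big(1-\frac{\eta+1}{\alpha}\big)\Gamma(\eta+1)}{\Gamma\big(1-\frac1\alpha\big)^{\eta+1}}+1\right)\le D(P\Vert Q)+\frac{\log(3.56)}{\min\{(\alpha-1)/2,1\}}.$$
   Context: Poisson private representation (PPR). Let $Q$ be a probability measure on a measurable space $\mathcal Z$ and $P$ a probability measure with $P\ll Q$. Let $Z_1,Z_2,\ldots$ be i.i.d. with law $Q$, and independently let $T_1\le T_2\le\cdots$ be the points of a homogeneous Poisson process of rate $1$ on $[0,\infty)$. Put $\tilde T_i:=T_i\cdot\big(\frac{\mathrm dP}{\mathrm dQ}(Z_i)\big)^{-1}$ ($:=\infty$ when the derivative is $0$, with $\infty^{-\alpha}:=0$). For $\alpha\in(1,\infty)$, PPR draws $K\in\{1,2,\ldots\}$ with $\Pr(K=k\mid (Z_i,T_i)_{i})=\tilde T_k^{-\alpha}/\sum_{i=1}^\infty\tilde T_i^{-\alpha}$, and outputs $Z_K$. $\Gamma$ is the Gamma function; logarithms and KL divergence are to the same base. *)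

theory Defs
  imports "HOL-Probability.Probability"
begin

text \<open>KL divergence D(P||Q) with values in the extended reals: the library's
  KL_divergence (a Bochner integral, which is 0 when not integrable) when the
  log-density is P-integrable, and +infinity otherwise (the negative part of the
  log-density is always P-integrable, so non-integrability means D = infinity).\<close>
definition kl_div :: "real \<Rightarrow> 'a measure \<Rightarrow> 'a measure \<Rightarrow> ereal" where
  "kl_div b P Q =
     (if integrable P (entropy_density b Q P) then ereal (KL_divergence b Q P) else \<infinity>)"

text \<open>Points of a rate-1 homogeneous Poisson process on [0,oo): partial sums of
  i.i.d. Exp(1) inter-arrival times e 0, e 1, ...  Index i (from 0) corresponds to
  T_(i+1).\<close>
definition ppr_arrival :: "(nat \<Rightarrow> real) \<Rightarrow> nat \<Rightarrow> real" where
  "ppr_arrival e i = (\<Sum>j\<le>i. e j)"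

text \<open>The score tilde T_(i+1)^(-alpha) = (dP/dQ(Z_(i+1)) / T_(i+1))^alpha
  (equal to 0 when the density is 0, i.e. tilde T = infinity).\<close>
definition ppr_score :: "real \<Rightarrow> ('a \<Rightarrow> real) \<Rightarrow> (nat \<Rightarrow> 'a) \<Rightarrow> (nat \<Rightarrow> real) \<Rightarrow> nat \<Rightarrow> real" where
  "ppr_score \<alpha> g z e i = (g (z i) / ppr_arrival e i) powr \<alpha>"

text \<open>Conditional probability that K = k+1 given the (Z_i, T_i).\<close>
definition ppr_index_prob ::
  "real \<Rightarrow> ('a \<Rightarrow> real) \<Rightarrow> (nat \<Rightarrow> 'a) \<Rightarrow> (nat \<Rightarrow> real) \<Rightarrow> nat \<Rightarrow> ennreal" where
  "ppr_index_prob \<alpha> g z e k =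
     ennreal (ppr_score \<alpha> g z e k) / (\<Sum>i. ennreal (ppr_score \<alpha> g z e i))"

definition ppr_space :: "'a measure \<Rightarrow> ((nat \<Rightarrow> 'a) \<times> (nat \<Rightarrow> real)) measure" where
  "ppr_space Q = (\<Pi>\<^sub>M i\<in>(UNIV::nat set). Q) \<Otimes>\<^sub>M
                 (\<Pi>\<^sub>M i\<in>(UNIV::nat set). density lborel (\<lambda>x. ennreal (exponential_density 1 x)))"

text \<open>E[log_b K], computed via the conditional law of K given (Z_i, T_i).\<close>
definition ppr_expected_log_index :: "real \<Rightarrow> real \<Rightarrow> 'a measure \<Rightarrow> 'a measure \<Rightarrow> ennreal" where
  "ppr_expected_log_index b \<alpha> P Q =
     (\<integral>\<^sup>+ \<omega>. (\<Sum>k. ppr_index_prob \<alpha> (\<lambda>x. enn2real (RN_deriv Q P x)) (fst \<omega>) (snd \<omega>) k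
                     * ennreal (log b (real (Suc k)))) \<partial>ppr_space Q)"

end

theory Submission
  imports Defs "HOL-Real_Asymp.Real_Asymp"
begin

text \<open>
  Write \<open>s\<^sub>k\<close> for the score of point \<open>k\<close> and \<open>S\<close> for the sum of all scores. Since
  \<open>s\<^sub>k / S = \<integral>\<^sub>0\<^sup>\<infinity> s\<^sub>k e\<^bsup>-x S\<^esup> dx\<close>, it suffices to control \<open>E[s\<^sub>k e\<^bsup>-x S\<^esup>]\<close> for fixed \<open>x\<close>. This is
  an expectation of a product over the points, so conditioning on the first point yields renewal
  equations. With \<open>\<phi>(v) = E\<^sub>Q exp (-x (g/v)\<^sup>\<alpha>)\<close>, \<open>g = dP/dQ\<close> and \<open>\<Phi>(v) = \<integral>\<^sub>0\<^sup>v \<phi>\<close> their solution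
  shows that the index of a chosen point with arrival time \<open>v\<close> is one plus a Poisson variable of mean
  \<open>\<Phi>(v) \<le> v\<close>, and that \<open>E e\<^bsup>-x S\<^esup> \<le> exp (-c x\<^bsup>1/\<alpha>\<^esup>)\<close> with \<open>c = \<Gamma>(1 - 1/\<alpha>)\<close>. By concavity of the
  logarithm \<open>E[ln K] \<le> E[ln (1 + g(Z) \<Theta>)]\<close>, where \<open>Z\<close> has law \<open>P\<close> and \<open>\<Theta>\<close> is independent with
  \<open>E[\<Theta>\<^sup>\<eta>] = \<Gamma>(1 - (\<eta>+1)/\<alpha>) \<Gamma>(\<eta>+1) / c\<^bsup>\<eta>+1\<^esup>\<close>. The bound follows from \<open>1 + y \<le> (1 + y\<^sup>\<eta>)\<^bsup>1/\<eta>\<^esup>\<close>,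
  Jensen's inequality and \<open>E\<^sub>P[1/g] \<le> 1\<close>.
\<close>

section \<open>Gamma function estimates\<close>

lemma Gamma_plus1_pos_real: "Gamma (x + 1) = x * Gamma x" if "0 < x" for x :: real
  using that by (intro Gamma_plus1) (auto dest: nonpos_Ints_nonpos)

text \<open>\<open>ln \<circ> Gamma\<close> is convex and vanishes at 1 and 2, so between them it
  lies below a zero chord.\<close>

lemma Gamma_le_1_real:
  fixes x :: real
  assumes "1 \<le> x" "x \<le> 2"
  shows "Gamma x \<le> 1"
proof -
  have "(ln \<circ> Gamma) ((1 - (x - 1)) *\<^sub>R 1 + (x - 1) *\<^sub>R 2)
      \<le> (1 - (x - 1)) * (ln \<circ> Gamma) 1 + (x - 1) * (ln \<circ> Gamma) (2::real)"
    by (rule convex_onD[OF log_convex_Gamma_real]) (use assms in auto)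
  moreover have "Gamma (2::real) = 1"
    using Gamma_plus1[of "1::real"] by simp
  ultimately have "ln (Gamma x) \<le> 0" by (simp add: algebra_simps)
  then show ?thesis using Gamma_real_pos[of x] assms by simp
qed

text \<open>Reflect \<open>x\<close> to \<open>3 - x\<close>. Log-convexity at the midpoint 3/2
  bounds the square of \<open>Gamma (3/2)\<close>, which is pi/4, by the product of the two values,
  and the value at the reflected point is at most 1.\<close>

lemma Gamma_ge_pi_quarter_real:
  fixes x :: real
  assumes "1 \<le> x" "x \<le> 2"
  shows "pi / 4 \<le> Gamma x"
proof -
  have pos: "Gamma x > 0" "Gamma (3 - x) > 0" "Gamma (3/2 :: real) > 0"
    using assms by (auto intro!: Gamma_real_pos)
  have "(ln \<circ> Gamma) ((1 - 1/2) *\<^sub>R x + (1/2) *\<^sub>R (3 - x))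
      \<le> (1 - 1/2) * (ln \<circ> Gamma) x + (1/2) * (ln \<circ> Gamma) (3 - x)"
    by (rule convex_onD[OF log_convex_Gamma_real]) (use assms in auto)
  moreover have "(1 - 1/2) *\<^sub>R x + (1/2) *\<^sub>R (3 - x) = 3/2"
    by (simp add: field_simps)
  ultimately have "2 * ln (Gamma (3/2)) \<le> ln (Gamma x) + ln (Gamma (3 - x))"
    by (simp only: o_def) simp
  then have "ln (Gamma (3/2) ^ 2) \<le> ln (Gamma x * Gamma (3 - x))"
    using pos by (simp add: ln_mult ln_realpow)
  then have "Gamma (3/2) ^ 2 \<le> Gamma x * Gamma (3 - x)"
    by (metis pos ln_le_cancel_iff zero_less_power mult_pos_pos)
  also have "\<dots> \<le> Gamma x * 1"
    using pos assms by (intro mult_left_mono Gamma_le_1_real) auto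
  also have "Gamma (3/2 :: real) = sqrt pi / 2"
    using Gamma_plus1_pos_real[of "1/2"] by (simp add: Gamma_one_half_real)
  finally show ?thesis by (simp add: power_divide)
qed

text \<open>The point 1 is a convex combination of \<open>x\<close> and 2. Since
  \<open>ln \<circ> Gamma\<close> vanishes at 1 and at 2, convexity leaves it no negative value at
  \<open>x\<close>.\<close>

lemma Gamma_ge_1_real:
  fixes x :: real
  assumes "0 < x" "x \<le> 1"
  shows "1 \<le> Gamma x"
proof -
  define l where "l = (1 - x) / (2 - x)"
  have l: "0 \<le> l" "l < 1" and eq: "(1 - l) * x + l * 2 = 1"
    using assms by (auto simp: l_def divide_simps)
  have "(ln \<circ> Gamma) ((1 - l) *\<^sub>R x + l *\<^sub>R 2) \<le> (1 - l) * (ln \<circ> Gamma) x + l * (ln \<circ> Gamma) 2"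
    by (rule convex_onD[OF log_convex_Gamma_real]) (use assms l in auto)
  moreover have "Gamma (2::real) = 1"
    using Gamma_plus1[of "1::real"] by simp
  ultimately have "0 \<le> (1 - l) * ln (Gamma x)" using eq by simp
  then have "0 \<le> ln (Gamma x)" using l by (simp add: zero_le_mult_iff)
  then show ?thesis using Gamma_real_pos[of x] assms by auto
qed

text \<open>The moment E[\<Theta>^\<eta>], as \<open>hmeas_moment\<close> shows. The theorem has
  this value plus one under the logarithm.\<close>

definition ppr_const :: "real \<Rightarrow> real \<Rightarrow> real" where
  "ppr_const \<alpha> \<eta> = Gamma (1 - (\<eta> + 1) / \<alpha>) * Gamma (\<eta> + 1) / Gamma (1 - 1 / \<alpha>) powr (\<eta> + 1)"

lemma ppr_const_nonneg:
  assumes "1 < \<alpha>" "0 \<le> \<eta>" "\<eta> < \<alpha> - 1"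
  shows "0 \<le> ppr_const \<alpha> \<eta>"
  unfolding ppr_const_def using assms
  by (intro divide_nonneg_nonneg mult_nonneg_nonneg Gamma_real_nonneg) auto

text \<open>In both branches of the minimum the functional equation moves the Gamma arguments into
  [1, 2], where pi/4 \<le> Gamma \<le> 1. This gives 8/pi for \<alpha> < 3 and 64/27 for \<alpha>
  \<ge> 3.\<close>

lemma ppr_const_le:
  assumes "1 < \<alpha>"
  shows "ppr_const \<alpha> (min ((\<alpha> - 1) / 2) 1) \<le> 2.56"
proof (cases "\<alpha> < 3")
  case True
  define y where "y = 1 - 1 / \<alpha>"
  define \<eta> where "\<eta> = (\<alpha> - 1) / 2"
  have y: "0 < y" "y < 1" and \<eta>: "0 < \<eta>" "\<eta> \<le> 1"
    using assms True by (auto simp: y_def \<eta>_def field_simps)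
  \<comment> \<open>This \<eta> makes one Gamma argument exactly half of the other, so that the
    poles at 0 cancel in the quotient below.\<close>
  have *: "1 - (\<eta> + 1) / \<alpha> = y / 2" using assms by (simp add: y_def \<eta>_def field_simps)
  have 1: "1 \<le> Gamma y" using y by (intro Gamma_ge_1_real) auto
  \<comment> \<open>Since \<open>Gamma y\<close> is at least 1, lowering the exponent of the
    denominator to 1 only enlarges the quotient.\<close>
  have "Gamma y powr 1 \<le> Gamma y powr (\<eta> + 1)" using 1 \<eta> by (intro powr_mono) auto
  then have 2: "Gamma y \<le> Gamma y powr (\<eta> + 1)" using 1 by simp
  have "Gamma (y/2) * Gamma (\<eta> + 1) / Gamma y powr (\<eta> + 1) \<le> Gamma (y/2) * 1 / Gamma y"
    using 1 2 y \<eta> by (intro frac_le mult_left_mono Gamma_le_1_real Gamma_real_nonneg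
      mult_nonneg_nonneg) auto
  also have "\<dots> = 2 * Gamma (y/2 + 1) / Gamma (y + 1)"
    using y by (simp add: Gamma_plus1_pos_real)
  also have "\<dots> \<le> 2 * 1 / (pi / 4)"
    using y Gamma_real_pos[of "y/2+1"]
      by (intro frac_le mult_left_mono Gamma_le_1_real Gamma_ge_pi_quarter_real) auto
  also have "\<dots> \<le> 2.56" using pi_approx by (simp add: field_simps)
  finally show ?thesis using True by (simp add: ppr_const_def
    * [unfolded \<eta>_def] \<eta>_def y_def[symmetric])
next
  case False
  define x where "x = 1 / \<alpha>"
  have x: "0 < x" "x \<le> 1/3" using assms False by (auto simp: x_def field_simps)
  have min: "min ((\<alpha> - 1) / 2) 1 = 1" using False by auto
  have 2: "Gamma (2::real) = 1" using Gamma_plus1[of "1::real"] by simp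
  have x2: "2 / \<alpha> = 2 * x" by (simp add: x_def)
  have G1: "Gamma (1 - x) = Gamma (2 - x) / (1 - x)"
    using Gamma_plus1_pos_real[of "1 - x"] x by simp
  have G2: "Gamma (1 - 2 * x) = Gamma (2 - 2 * x) / (1 - 2 * x)"
    using Gamma_plus1_pos_real[of "1 - 2 * x"] x by simp
  \<comment> \<open>The constant 4/3 is the value of the quotient below at x = 1/3, that is at
    \<alpha> = 3.\<close>
  have "(4/3 * (1 - 2 * x)) - (1 - x)\<^sup>2 = (1/3 - x) * (1 + x)"
    by (simp add: power2_eq_square field_simps)
  also have "\<dots> \<ge> 0" using x by simp
  finally have fr: "(1 - x)\<^sup>2 / (1 - 2 * x) \<le> 4/3" using x by (simp add: field_simps)
  have pos: "0 < Gamma (2 - x)" using x by simp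
  have "Gamma (1 - 2 * x) / (Gamma (1 - x))\<^sup>2
     = Gamma (2 - 2 * x) * ((1 - x)\<^sup>2 / (1 - 2 * x)) / (Gamma (2 - x))\<^sup>2"
    by (simp add: G1 G2 power_divide)
  also have "\<dots> \<le> 1 * (4/3) / (pi / 4)\<^sup>2"
    using x pos
    by (intro frac_le[OF _ mult_mono[OF Gamma_le_1_real fr]] power_mono Gamma_ge_pi_quarter_real)
      auto
  also have "\<dots> \<le> 1 * (4/3) / (3/4)\<^sup>2" using pi_gt3 by (intro divide_left_mono power_mono) auto
  also have "\<dots> \<le> 2.56" by (simp add: power2_eq_square)
  finally show ?thesis
    using x by (simp add: ppr_const_def min 2 x2 x_def[symmetric] Gamma_real_pos)
qed

section \<open>Renewal equations\<close>

text \<open>Up to the factor exp p this is Jensen's inequality for ln (1 + N) with N Poisson of mean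
  \<open>p\<close>. Using the tangent at the mean, only the series for the mass and for the mean of
  N have to be summed.\<close>

lemma suminf_ln_power_le:
  fixes p :: real
  assumes "0 \<le> p"
  shows "(\<Sum>k. ennreal (ln (real (Suc k))) * ennreal (p ^ k / fact k)) \<le> ennreal (exp p * ln (1
    + p))"
proof -
  \<comment> \<open>The value at k = 0 of the tangent to \<open>ln\<close> at \<open>1 + p\<close>,
    taken as an affine function of k through the argument k + 1.\<close>
  define a where "a = ln (1 + p) - p / (1 + p)"
  have tangent: "ln (real (Suc k)) \<le> a + real k / (1 + p)" for k
  proof -
    have "ln (real (Suc k) / (1 + p)) \<le> real (Suc k) / (1 + p) - 1"
      using assms by (intro ln_le_minus_one) auto
    also have "\<dots> = real k / (1 + p) - p / (1 + p)" using assms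
      by (simp add: diff_divide_distrib[symmetric] field_simps)
    finally show ?thesis using assms by (simp add: ln_div a_def)
  qed
  have e: "(\<lambda>k. p ^ k / fact k) sums exp p"
    using exp_converges[of p] by (simp add: field_simps)
  have "(\<lambda>k. real (Suc k) * (p ^ Suc k / fact (Suc k))) = (\<lambda>k. p * (p ^ k / fact k))"
    by (auto simp: field_simps simp del: of_nat_Suc)
  then have "(\<lambda>k. real (Suc k) * (p ^ Suc k / fact (Suc k))) sums (p * exp p)"
    using sums_mult[OF e, of p] by simp
  \<comment> \<open>The term at k = 0 vanishes, so undoing the index shift keeps the sum.\<close>
  then have k: "(\<lambda>k. real k * (p ^ k / fact k)) sums (p * exp p)"
    by (subst (asm) sums_Suc_iff) simp
  have "(\<lambda>k. a * (p ^ k / fact k) + (1 / (1 + p)) * (real k * (p ^ k / fact k)))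
      sums (a * exp p + (1 / (1 + p)) * (p * exp p))"
    by (intro sums_add sums_mult e k)
  also have "a * exp p + (1 / (1 + p)) * (p * exp p) = exp p * ln (1 + p)"
    by (simp add: a_def left_diff_distrib)
  also have "(\<lambda>k. a * (p ^ k / fact k) + (1 / (1 + p)) * (real k * (p ^ k / fact k)))
      = (\<lambda>k. (a + real k / (1 + p)) * (p ^ k / fact k))"
    by (simp add: algebra_simps)
  finally have s: "(\<lambda>k. (a + real k / (1 + p)) * (p ^ k / fact k)) sums (exp p * ln (1 + p))" .
  \<comment> \<open>The tangent lies above ln (k + 1) \<ge> 0, so the coercion to
    \<open>ennreal\<close> truncates nothing.\<close>
  have nn: "0 \<le> (a + real k / (1 + p)) * (p ^ k / fact k)" for k
    using tangent[of k] assms by (intro mult_nonneg_nonneg) (auto intro: order_trans[rotated])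
  have "(\<Sum>k. ennreal (ln (real (Suc k))) * ennreal (p ^ k / fact k))
      \<le> (\<Sum>k. ennreal ((a + real k / (1 + p)) * (p ^ k / fact k)))"
    using tangent assms
    by (intro suminf_le) (auto simp: ennreal_mult[symmetric] intro!: ennreal_leI divide_right_mono
      mult_right_mono simp del: of_nat_Suc)
  also have "\<dots> = ennreal (exp p * ln (1 + p))"
    by (rule suminf_ennreal_eq[OF nn s])
  finally show ?thesis .
qed

text \<open>Unfolding the recursion integrates a product of k values of \<phi> over ordered points
  between \<open>t\<close> and \<open>v\<close>. That simplex has mass (\<Phi> v - \<Phi> t)^k / k!.
  The induction peels off the smallest point.\<close>

lemma nn_integral_iterated_weights:
  fixes \<phi> \<Phi> :: "real \<Rightarrow> real" and W :: "real \<Rightarrow> ennreal" and J :: "nat \<Rightarrow> real \<Rightarrow> ennreal"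
  assumes \<Phi>: "\<And>t. DERIV \<Phi> t :> \<phi> t"
    and \<phi>[measurable]: "\<phi> \<in> borel_measurable borel" and nn: "\<And>t. 0 \<le> \<phi> t"
    and W[measurable]: "W \<in> borel_measurable borel"
    and J0: "\<And>t. 0 \<le> t \<Longrightarrow> J 0 t = (\<integral>\<^sup>+v. W v * indicator {t<..} v \<partial>lborel)"
    and JS: "\<And>k t. 0 \<le> t \<Longrightarrow> J (Suc k) t = (\<integral>\<^sup>+v. ennreal (\<phi> v) * J k v * indicator {t<..} v \<partial>lborel)"
    and "0 \<le> t"
  shows "J k t = (\<integral>\<^sup>+v. ennreal ((\<Phi> v - \<Phi> t) ^ k / fact k) * W v * indicator {t<..} v \<partial>lborel)"
  using \<open>0 \<le> t\<close>
proof (induction k arbitrary: t)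
  case 0
  then show ?case by (simp add: J0)
next
  case (Suc k)
  have "continuous_on UNIV \<Phi>"
    using \<Phi> by (auto intro!: continuous_at_imp_continuous_on DERIV_isCont)
  then have [measurable]: "\<Phi> \<in> borel_measurable borel"
    by (rule borel_measurable_continuous_onI)
  have mono: "\<Phi> u \<le> \<Phi> v" if "u \<le> v" for u v
    using that \<Phi> nn by (intro DERIV_nonneg_imp_nondecreasing[of u v \<Phi>]) auto
  \<comment> \<open>An antiderivative in u is -(\<Phi> v - \<Phi> u)^(k+1) / (k+1)!. Passing to the
    closed interval adds two null points.\<close>
  have inner: "(\<integral>\<^sup>+u. ennreal (\<phi> u) * ennreal ((\<Phi> v - \<Phi> u) ^ k / fact k)
    * indicator {t<..<v} u \<partial>lborel)
      = ennreal ((\<Phi> v - \<Phi> t) ^ Suc k / fact (Suc k))" if "t < v" for v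
  proof -
    have "(\<integral>\<^sup>+u. ennreal (\<phi> u) * ennreal ((\<Phi> v - \<Phi> u) ^ k / fact k) * indicator {t<..<v} u \<partial>lborel)
       = (\<integral>\<^sup>+u. ennreal (\<phi> u * ((\<Phi> v - \<Phi> u) ^ k / fact k)) * indicator {t..v} u \<partial>lborel)"
      using AE_lborel_singleton[of t] AE_lborel_singleton[of v]
      by (intro nn_integral_cong_AE, eventually_elim)
         (auto simp: indicator_def ennreal_mult'[symmetric] nn)
    also have "\<dots> = ennreal (- ((\<Phi> v - \<Phi> v) ^ Suc k / fact (Suc k)) - (- ((\<Phi> v - \<Phi> t) ^ Suc k / fact
      (Suc k))))"
    proof (rule nn_integral_FTC_Icc)
      fix u assume u: "u \<in> {t..v}"
      show "0 \<le> \<phi> u * ((\<Phi> v - \<Phi> u) ^ k / fact k)"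
        using u mono[of u v] nn[of u] by auto
      show "DERIV (\<lambda>u. - ((\<Phi> v - \<Phi> u) ^ Suc k / fact (Suc k))) u :> \<phi> u
        * ((\<Phi> v - \<Phi> u) ^ k / fact k)"
        by (rule derivative_eq_intros \<Phi> refl | simp)+
    qed (use that in auto)
    finally show ?thesis by simp
  qed
  have "J (Suc k) t = (\<integral>\<^sup>+u. ennreal (\<phi> u) * (\<integral>\<^sup>+v. ennreal ((\<Phi> v - \<Phi> u) ^ k / fact k) * W v
    * indicator {u<..} v \<partial>lborel) * indicator {t<..} u \<partial>lborel)"
    unfolding JS[OF Suc.prems]
  proof (intro nn_integral_cong)
    fix u show "ennreal (\<phi> u) * J k u * indicator {t<..} u
      = ennreal (\<phi> u) * (\<integral>\<^sup>+v. ennreal ((\<Phi> v - \<Phi> u) ^ k / fact k) * W v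
        * indicator {u<..} v \<partial>lborel) * indicator {t<..} u"
      using Suc.IH[of u] Suc.prems by (cases "t < u") auto
  qed
  also have "\<dots> = (\<integral>\<^sup>+u. (\<integral>\<^sup>+v. (W v * indicator {t<..} v) * (ennreal (\<phi> u)
    * ennreal ((\<Phi> v - \<Phi> u) ^ k / fact k) * indicator {t<..<v} u) \<partial>lborel) \<partial>lborel)"
    by (intro nn_integral_cong, subst nn_integral_cmult[symmetric], measurable,
      subst nn_integral_multc[symmetric], measurable, intro nn_integral_cong)
       (auto simp: indicator_def mult_ac)
  also have "\<dots> = (\<integral>\<^sup>+v. (\<integral>\<^sup>+u. (W v * indicator {t<..} v) * (ennreal (\<phi> u)
    * ennreal ((\<Phi> v - \<Phi> u) ^ k / fact k) * indicator {t<..<v} u) \<partial>lborel) \<partial>lborel)"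
    by (rule lborel_pair.Fubini') (measurable, unfold greaterThanLessThan_iff, measurable)
  also have "\<dots> = (\<integral>\<^sup>+v. ennreal ((\<Phi> v - \<Phi> t) ^ Suc k / fact (Suc k)) * W v
    * indicator {t<..} v \<partial>lborel)"
  proof (intro nn_integral_cong)
    fix v
    show "(\<integral>\<^sup>+u. (W v * indicator {t<..} v) * (ennreal (\<phi> u) * ennreal ((\<Phi> v - \<Phi> u) ^ k / fact k)
      * indicator {t<..<v} u) \<partial>lborel)
        = ennreal ((\<Phi> v - \<Phi> t) ^ Suc k / fact (Suc k)) * W v * indicator {t<..} v"
      by (subst nn_integral_cmult, measurable) (use inner[of v] in \<open>auto simp: indicator_def mult_ac
        simp del: power_Suc fact_Suc\<close>)
  qed
  finally show ?case .
qed

text \<open>The bound solves the renewal equation up to the time horizon \<open>V\<close> with value \<open>exp (- V)\<close> there;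
  the error contracts by the factor \<open>r = 1 - exp (- V)\<close> with every iteration of the equation.\<close>
lemma renewal_subsolution_le:
  fixes \<phi> \<Phi> :: "real \<Rightarrow> real" and H :: "real \<Rightarrow> ennreal"
  assumes \<Phi>: "\<And>t. DERIV \<Phi> t :> \<phi> t"
    and \<phi>[measurable]: "\<phi> \<in> borel_measurable borel" and nn: "\<And>t. 0 \<le> \<phi> t" and le1: "\<And>t. \<phi> t \<le> 1"
    and H_le: "\<And>t. 0 \<le> t \<Longrightarrow> H t \<le> ennreal (exp (- t))"
    and H_eq: "\<And>t. 0 \<le> t \<Longrightarrow> H t \<le> (\<integral>\<^sup>+v. ennreal (\<phi> v) * H v * indicator {t<..} v \<partial>lborel)"
    and t: "0 \<le> t" "t \<le> V"
  shows "H t \<le> ennreal (exp (\<Phi> V - V - \<Phi> t))"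
proof -
  have "continuous_on UNIV \<Phi>"
    using \<Phi> by (auto intro!: continuous_at_imp_continuous_on DERIV_isCont)
  then have [measurable]: "\<Phi> \<in> borel_measurable borel"
    by (rule borel_measurable_continuous_onI)
  define r where "r = 1 - exp (- V)"
  have r: "0 \<le> r" "r < 1" using t by (auto simp: r_def)
  \<comment> \<open>At m = 0 the error term exp (- t) alone is already the crude bound
    \<open>H_le\<close>.\<close>
  have step: "H t \<le> ennreal (exp (\<Phi> V - V - \<Phi> t) + exp (- t) * r ^ m)" if "0 \<le> t" "t \<le> V" for m t
    using that
  proof (induction m arbitrary: t)
    case 0
    then show ?case using H_le[of t] by (auto elim!: order_trans intro!: ennreal_leI)
  next
    case (Suc m)
    have tail: "(\<integral>\<^sup>+v. ennreal (exp (- v)) * indicator {V..} v \<partial>lborel)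
      = ennreal (0 - (- exp (- V)))"
    proof (rule nn_integral_FTC_atLeast)
      show "((\<lambda>v. - exp (- v)) \<longlongrightarrow> (0::real)) at_top" by real_asymp
    qed (auto intro!: derivative_eq_intros)
    have FTC1: "(\<integral>\<^sup>+v. ennreal (\<phi> v * exp (\<Phi> V - V - \<Phi> v)) * indicator {t..V} v \<partial>lborel)
        = ennreal (- exp (\<Phi> V - V - \<Phi> V) - (- exp (\<Phi> V - V - \<Phi> t)))"
      by (rule nn_integral_FTC_Icc) (use nn Suc.prems in \<open>auto intro!: derivative_eq_intros \<Phi>\<close>)
    have FTC2: "(\<integral>\<^sup>+v. ennreal (exp (- v) * r ^ m) * indicator {t..V} v \<partial>lborel)
        = ennreal (- exp (- V) * r ^ m - (- exp (- t) * r ^ m))"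
      by (rule nn_integral_FTC_Icc) (use r Suc.prems in \<open>auto intro!: derivative_eq_intros\<close>)
    have "H t \<le> (\<integral>\<^sup>+v. ennreal (\<phi> v) * H v * indicator {t<..} v \<partial>lborel)"
      using Suc.prems by (intro H_eq)
    \<comment> \<open>Split at \<open>V\<close>. Below it the induction hypothesis applies, with
      \<phi> \<le> 1 used on the error part only; beyond it \<phi> \<le> 1 and \<open>H_le\<close>
      leave a tail of mass exp (- V).\<close>
    also have "\<dots> \<le> (\<integral>\<^sup>+v. ennreal (\<phi> v * exp (\<Phi> V - V - \<Phi> v)) * indicator {t..V} v
          + ennreal (exp (- v) * r ^ m) * indicator {t..V} v + ennreal (exp (- v))
            * indicator {V..} v \<partial>lborel)"
    proof (intro nn_integral_mono)
      fix v
      consider "v \<le> t" | "t < v" "v \<le> V" | "V < v" by linarith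
      then show "ennreal (\<phi> v) * H v * indicator {t<..} v \<le> ennreal (\<phi> v * exp (\<Phi> V - V - \<Phi> v))
        * indicator {t..V} v
          + ennreal (exp (- v) * r ^ m) * indicator {t..V} v + ennreal (exp (- v))
            * indicator {V..} v"
      proof cases
        case 2
        have "ennreal (\<phi> v) * H v \<le> ennreal (\<phi> v) * ennreal (exp (\<Phi> V - V - \<Phi> v) + exp (- v)
          * r ^ m)"
          using 2 Suc.prems by (intro mult_left_mono Suc.IH) auto
        also have "\<dots> = ennreal (\<phi> v * exp (\<Phi> V - V - \<Phi> v) + \<phi> v * (exp (- v) * r ^ m))"
          using nn by (simp add: ennreal_mult'[symmetric] algebra_simps)
        also have "\<dots> \<le> ennreal (\<phi> v * exp (\<Phi> V - V - \<Phi> v) + 1 * (exp (- v) * r ^ m))"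
          using le1 r by (intro ennreal_leI add_left_mono mult_right_mono) auto
        also have "\<dots> = ennreal (\<phi> v * exp (\<Phi> V - V - \<Phi> v)) + ennreal (exp (- v) * r ^ m)"
          using nn r by (subst ennreal_plus[symmetric]) auto
        also have "\<dots> \<le> \<dots> + ennreal (exp (- v)) * indicator {V..} v" by simp
        finally show ?thesis using 2 by (simp add: indicator_def)
      next
        case 3
        have "ennreal (\<phi> v) * H v \<le> ennreal 1 * ennreal (exp (- v))"
          using le1 3 Suc.prems by (intro mult_mono H_le ennreal_leI) auto
        then show ?thesis using 3 Suc.prems by (simp add: indicator_def)
      qed auto
    qed
    also have "\<dots> = ennreal (- exp (\<Phi> V - V - \<Phi> V) - (- exp (\<Phi> V - V - \<Phi> t)))
        + ennreal (- exp (- V) * r ^ m - (- exp (- t) * r ^ m)) + ennreal (0 - (- exp (- V)))"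
      by (subst nn_integral_add, measurable, subst nn_integral_add, measurable) (simp only: FTC1
        FTC2 tail)
    also have "\<dots> = ennreal ((exp (\<Phi> V - V - \<Phi> t) - exp (- V)) + (exp (- t) - exp (- V)) * r ^ m
      + exp (- V))"
    proof -
      have "\<Phi> V - V - \<Phi> t \<ge> - V"
        using DERIV_nonneg_imp_nondecreasing[of t V \<Phi>] Suc.prems \<Phi> nn by force
      then have "0 \<le> exp (\<Phi> V - V - \<Phi> t) - exp (- V)" by simp
      moreover have "0 \<le> (exp (- t) - exp (- V)) * r ^ m" using r Suc.prems by simp
      ultimately have "ennreal ((exp (\<Phi> V - V - \<Phi> t) - exp (- V)) + (exp (- t) - exp (- V)) * r ^ m
        + exp (- V))
          = ennreal (exp (\<Phi> V - V - \<Phi> t) - exp (- V)) + ennreal ((exp (- t) - exp (- V)) * r ^ m)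
            + ennreal (exp (- V))"
        by (metis add_nonneg_nonneg ennreal_plus exp_ge_zero)
      then show ?thesis by (simp add: algebra_simps)
    qed
    also have "\<dots> \<le> ennreal (exp (\<Phi> V - V - \<Phi> t) + exp (- t) * r ^ Suc m)"
    proof -
      \<comment> \<open>The contraction factor \<open>r\<close> appears here, by way of t \<ge>
        0.\<close>
      have "exp (- t) * exp (- V) \<le> 1 * exp (- V)" using Suc.prems by (intro mult_right_mono) auto
      then have "exp (- t) - exp (- V) \<le> exp (- t) * r" by (simp add: r_def algebra_simps)
      then have "(exp (- t) - exp (- V)) * r ^ m \<le> (exp (- t) * r) * r ^ m" using r
        by (intro mult_right_mono) auto
      then show ?thesis by (intro ennreal_leI) (simp add: mult_ac)
    qed
    finally show ?case .
  qed
  have "(\<lambda>m. ennreal (exp (\<Phi> V - V - \<Phi> t) + exp (- t) * r ^ m)) \<longlonglongrightarrow> ennreal (exp (\<Phi> V - V - \<Phi> t)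
    + exp (- t) * 0)"
    using r by (intro tendsto_ennrealI tendsto_intros LIMSEQ_power_zero) auto
  then show ?thesis
    by (intro LIMSEQ_le_const[where X="\<lambda>m. ennreal (exp (\<Phi> V - V - \<Phi> t) + exp (- t)
      * r ^ m)"]) (use step[OF t] in auto)
qed

section \<open>Exponential functionals of marked Poisson processes\<close>

text \<open>The sum of all scores is formed in \<open>ennreal\<close>, so exp (- S) is also needed
  at \<open>\<top>\<close>. The value 0 there keeps the rule that sums become products.\<close>

definition eexp :: "ennreal \<Rightarrow> ennreal" where
  "eexp S = (if S = \<top> then 0 else ennreal (exp (- enn2real S)))"

lemma eexp_ennreal: "0 \<le> a \<Longrightarrow> eexp (ennreal a) = ennreal (exp (- a))"
  by (simp add: eexp_def)

lemma eexp_add: "eexp (a + b) = eexp a * eexp b"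
  by (cases a; cases b) (auto simp: eexp_def ennreal_mult[symmetric] ennreal_plus[symmetric]
    exp_add[symmetric]
      simp del: ennreal_plus)

lemma eexp_le_1: "eexp S \<le> 1"
  by (auto simp: eexp_def intro!: ennreal_le_1[THEN iffD2])

lemma measurable_eexp[measurable]: "eexp \<in> borel_measurable borel"
  unfolding eexp_def[abs_def] by measurable

lemma nn_integral_eexp:
  assumes "S \<noteq> 0"
  shows "(\<integral>\<^sup>+x. eexp (ennreal x * S) * indicator {0<..} x \<partial>lborel) = inverse S"
proof -
  consider "S = \<top>" | r where "0 < r" "S = ennreal r"
    using assms by (cases S) (auto simp: less_le)
  then show ?thesis
  proof cases
    case 1
    then have "(\<integral>\<^sup>+x. eexp (ennreal x * S) * indicator {0<..} x \<partial>lborel)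
      = nn_integral lborel (\<lambda>x::real. 0)"
      by (intro nn_integral_cong) (auto simp: indicator_def eexp_def ennreal_mult_top)
    with 1 show ?thesis by simp
  next
    case (2 r)
    have "(\<integral>\<^sup>+x. eexp (ennreal x * S) * indicator {0<..} x \<partial>lborel)
       = (\<integral>\<^sup>+x. ennreal (exp (- (x * r))) * indicator {0..} x \<partial>lborel)"
      using AE_lborel_singleton[of 0]
      by (intro nn_integral_cong_AE, eventually_elim)
         (use 2 in \<open>auto simp: indicator_def ennreal_mult[symmetric] eexp_ennreal\<close>)
    also have "\<dots> = ennreal (0 - (- exp (- (0 * r)) / r))"
    proof (rule nn_integral_FTC_atLeast)
      show "((\<lambda>x. - exp (- (x * r)) / r) \<longlongrightarrow> 0) at_top"
        using \<open>0 < r\<close> by real_asymp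
    qed (use 2 in \<open>auto intro!: derivative_eq_intros\<close>)
    finally show ?thesis using 2 by (simp add: inverse_ennreal inverse_eq_divide)
  qed
qed

text \<open>The representation of a score divided by the total. When S = 0 both sides vanish, since
  0 / 0 = 0 in \<open>ennreal\<close>.\<close>

lemma nn_integral_eexp_cmult:
  assumes "S = 0 \<Longrightarrow> a = 0"
  shows "(\<integral>\<^sup>+x. a * eexp (ennreal x * S) * indicator {0<..} x \<partial>lborel) = a / S"
  using assms by (cases "S = 0") (auto simp: mult.assoc nn_integral_cmult nn_integral_eexp
    divide_ennreal_def)

section \<open>Splitting off the first point of the process\<close>

abbreviation std_exponential :: "real measure" where
  "std_exponential \<equiv> density lborel (\<lambda>x. ennreal (exponential_density 1 x))"

lemma prob_space_std_exponential: "prob_space std_exponential"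
  by (rule prob_space_exponential_density) simp

text \<open>Substitution v = t + s. After weighting by exp (- t), the starting time enters the
  right-hand side only through the lower limit, which is what lets the renewal equations be
  iterated.\<close>

lemma nn_integral_std_exponential_shift:
  assumes [measurable]: "f \<in> borel_measurable borel"
  shows "ennreal (exp (- t)) * (\<integral>\<^sup>+s. f (t + s) \<partial>std_exponential)
       = (\<integral>\<^sup>+v. f v * ennreal (exp (- v)) * indicator {t<..} v \<partial>lborel)"
proof -
  have "(\<integral>\<^sup>+v. f v * ennreal (exp (- v)) * indicator {t<..} v \<partial>lborel)
     = (\<integral>\<^sup>+s. f (t + s) * ennreal (exp (- (t + s))) * indicator {t<..} (t + s) \<partial>lborel)"
    by (subst nn_integral_real_affine[where c=1 and t=t]) auto
  also have "\<dots> = (\<integral>\<^sup>+s. ennreal (exp (- t)) * (ennreal (exponential_density 1 s) * f (t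
    + s)) \<partial>lborel)"
    \<comment> \<open>At s = 0 the exponential density is 1 but the indicator is 0, so this null
      point is excluded.\<close>
    using AE_lborel_singleton[of 0]
  proof (intro nn_integral_cong_AE, eventually_elim)
    fix s :: real assume "s \<noteq> 0"
    have "ennreal (exp (- (t + s))) = ennreal (exp (- t)) * ennreal (exp (- s))"
      by (simp add: ennreal_mult'[symmetric] exp_add[symmetric])
    with \<open>s \<noteq> 0\<close> show "f (t + s) * ennreal (exp (- (t + s))) * indicator {t<..} (t + s)
        = ennreal (exp (- t)) * (ennreal (exponential_density 1 s) * f (t + s))"
      by (cases "s < 0") (auto simp: exponential_density_def mult_ac)
  qed
  also have "\<dots> = ennreal (exp (- t)) * (\<integral>\<^sup>+s. f (t + s) \<partial>std_exponential)"
    by (subst nn_integral_density) (auto simp: nn_integral_cmult)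
  finally show ?thesis by simp
qed

lemma nn_integral_PiM_nat_iter:
  assumes "prob_space M" and [measurable]: "f \<in> borel_measurable (\<Pi>\<^sub>M i\<in>(UNIV::nat set). M)"
  shows "(\<integral>\<^sup>+\<omega>. f \<omega> \<partial>(\<Pi>\<^sub>M i\<in>(UNIV::nat set). M))
       = (\<integral>\<^sup>+x. (\<integral>\<^sup>+\<omega>. f (case_nat x \<omega>) \<partial>(\<Pi>\<^sub>M i\<in>(UNIV::nat set). M)) \<partial>M)"
proof -
  interpret M: prob_space M by fact
  interpret sequence_space M
    unfolding sequence_space_def by (intro product_prob_spaceI) (rule M.prob_space_axioms)
  have "(\<integral>\<^sup>+\<omega>. f \<omega> \<partial>S) = (\<integral>\<^sup>+\<omega>. f \<omega> \<partial>distr (M \<Otimes>\<^sub>M S) S (\<lambda>(s, \<omega>). case_nat s \<omega>))"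
    by (simp add: PiM_iter)
  also have "\<dots> = (\<integral>\<^sup>+p. f (case_nat (fst p) (snd p)) \<partial>(M \<Otimes>\<^sub>M S))"
    by (subst nn_integral_distr) (auto simp: split_beta')
  also have "\<dots> = (\<integral>\<^sup>+x. (\<integral>\<^sup>+\<omega>. f (case_nat x \<omega>) \<partial>S) \<partial>M)"
    by (subst P.nn_integral_fst[symmetric]) auto
  finally show ?thesis .
qed

lemma prob_space_ppr_space:
  assumes "prob_space Q" shows "prob_space (ppr_space Q)"
  unfolding ppr_space_def
  by (intro prob_space_pair prob_space_PiM prob_space_std_exponential assms)

lemma measurable_ppr_space_marks[measurable (raw)]:
  assumes "f \<in> M \<rightarrow>\<^sub>M ppr_space Q"
  shows "(\<lambda>x. fst (f x) i) \<in> M \<rightarrow>\<^sub>M Q"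
proof -
  have "(\<lambda>\<omega>. fst \<omega> i) \<in> ppr_space Q \<rightarrow>\<^sub>M Q"
    unfolding ppr_space_def by measurable
  from measurable_compose[OF assms this] show ?thesis .
qed

lemma measurable_ppr_arrival[measurable (raw)]:
  assumes "f \<in> M \<rightarrow>\<^sub>M ppr_space Q"
  shows "(\<lambda>x. ppr_arrival (snd (f x)) i) \<in> borel_measurable M"
proof -
  have "(\<lambda>\<omega>. snd \<omega> j) \<in> ppr_space Q \<rightarrow>\<^sub>M std_exponential" for j
    unfolding ppr_space_def by measurable
  then have "(\<lambda>\<omega>. snd \<omega> j) \<in> ppr_space Q \<rightarrow>\<^sub>M borel" for j
    by simp
  then have "(\<lambda>\<omega>. ppr_arrival (snd \<omega>) i) \<in> borel_measurable (ppr_space Q)"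
    unfolding ppr_arrival_def by (intro borel_measurable_sum) auto
  from measurable_compose[OF assms this] show ?thesis .
qed

text \<open>The first mark and the first gap are independent of the remaining sequences, which have
  the original joint law. The gap is integrated last, ready for
  \<open>nn_integral_std_exponential_shift\<close>.\<close>

lemma nn_integral_ppr_space_iter:
  assumes "prob_space Q" and "F \<in> borel_measurable (ppr_space Q)"
  shows "(\<integral>\<^sup>+\<omega>. F \<omega> \<partial>ppr_space Q)
       = (\<integral>\<^sup>+s. (\<integral>\<^sup>+z. (\<integral>\<^sup>+\<omega>. F (case_nat z (fst \<omega>), case_nat s (snd \<omega>)) \<partial>ppr_space Q) \<partial>Q)
         \<partial>std_exponential)"
proof -
  let ?N = std_exponential
  let ?SQ = "\<Pi>\<^sub>M i\<in>(UNIV::nat set). Q" and ?SN = "\<Pi>\<^sub>M i\<in>(UNIV::nat set). ?N"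
  interpret Q: prob_space Q by fact
  interpret N: prob_space ?N by (rule prob_space_std_exponential)
  interpret SQ: prob_space ?SQ by (intro prob_space_PiM assms)
  interpret SN: prob_space ?SN by (intro prob_space_PiM prob_space_std_exponential)
  interpret SS: pair_sigma_finite ?SQ ?SN ..
  interpret QN: pair_sigma_finite ?SQ ?N ..
  interpret NQ: pair_sigma_finite Q ?N ..
  have F[measurable]: "F \<in> borel_measurable (?SQ \<Otimes>\<^sub>M ?SN)"
    using assms(2) by (simp add: ppr_space_def)
  have "(\<integral>\<^sup>+\<omega>. F \<omega> \<partial>ppr_space Q) = (\<integral>\<^sup>+z. (\<integral>\<^sup>+e. F (z, e) \<partial>?SN) \<partial>?SQ)"
    unfolding ppr_space_def by (subst SN.nn_integral_fst[symmetric]) auto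
  also have "\<dots> = (\<integral>\<^sup>+z. (\<integral>\<^sup>+s. (\<integral>\<^sup>+e. F (z, case_nat s e) \<partial>?SN) \<partial>?N) \<partial>?SQ)"
    by (intro nn_integral_cong nn_integral_PiM_nat_iter prob_space_std_exponential) measurable
  also have "\<dots> = (\<integral>\<^sup>+s. (\<integral>\<^sup>+z. (\<integral>\<^sup>+e. F (z, case_nat s e) \<partial>?SN) \<partial>?SQ) \<partial>?N)"
    by (rule QN.Fubini'[symmetric]) measurable
  also have "\<dots> = (\<integral>\<^sup>+s. (\<integral>\<^sup>+z0. (\<integral>\<^sup>+z. (\<integral>\<^sup>+e. F (case_nat z0 z, case_nat s e) \<partial>?SN) \<partial>?SQ) \<partial>Q) \<partial>?N)"
    by (intro nn_integral_cong nn_integral_PiM_nat_iter assms) measurable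
  also have "\<dots> = (\<integral>\<^sup>+s. (\<integral>\<^sup>+z. (\<integral>\<^sup>+\<omega>. F (case_nat z (fst \<omega>), case_nat s (snd \<omega>)) \<partial>ppr_space Q) \<partial>Q)
    \<partial>?N)"
    unfolding ppr_space_def
  proof (intro nn_integral_cong)
    fix s z assume [simp]: "z \<in> space Q"
    have "(\<lambda>\<omega>. (case_nat z (fst \<omega>), case_nat s (snd \<omega>))) \<in> ?SQ \<Otimes>\<^sub>M ?SN \<rightarrow>\<^sub>M ?SQ \<Otimes>\<^sub>M ?SN"
      by (intro measurable_Pair measurable_case_nat' measurable_fst measurable_snd measurable_const)
        auto
    from measurable_compose[OF this F]
    show "(\<integral>\<^sup>+z'. (\<integral>\<^sup>+e. F (case_nat z z', case_nat s e) \<partial>?SN) \<partial>?SQ)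
        = (\<integral>\<^sup>+\<omega>. F (case_nat z (fst \<omega>), case_nat s (snd \<omega>)) \<partial>(?SQ \<Otimes>\<^sub>M ?SN))"
      by (subst SN.nn_integral_fst[symmetric]) simp_all
  qed
  finally show ?thesis .
qed

lemma ppr_arrival_case_nat_0 [simp]: "ppr_arrival (case_nat s e) 0 = s"
  by (simp add: ppr_arrival_def)

lemma ppr_arrival_case_nat_Suc [simp]: "ppr_arrival (case_nat s e) (Suc i) = s + ppr_arrival e i"
  unfolding ppr_arrival_def by (subst sum.atMost_Suc_shift) simp

section \<open>Renewal equations for products over the points of a marked Poisson process\<close>

locale marked_poisson = prob_space Q for Q :: "'a measure" +
  fixes \<kappa> \<rho> :: "'a \<Rightarrow> real \<Rightarrow> ennreal"
  assumes \<kappa>[measurable]: "case_prod \<kappa> \<in> borel_measurable (Q \<Otimes>\<^sub>M borel)"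
    and \<rho>[measurable]: "case_prod \<rho> \<in> borel_measurable (Q \<Otimes>\<^sub>M borel)"
begin

text \<open>All arrival times are shifted by \<open>t\<close>, which makes the functionals below closed under removing
  the first point.\<close>
definition energy :: "real \<Rightarrow> (nat \<Rightarrow> 'a) \<times> (nat \<Rightarrow> real) \<Rightarrow> ennreal" where
  "energy t \<omega> = (\<Sum>i. \<kappa> (fst \<omega> i) (t + ppr_arrival (snd \<omega>) i))"

text \<open>An ordinary point arriving at \<open>v\<close> contributes the factor
  \<open>wt v\<close> on average, and the selected point contributes \<open>mark v\<close>.
  \<open>G\<close> is the expected product with no point selected, \<open>J k\<close> the one with
  point \<open>k\<close> selected, counted from 0.\<close>

definition "wt v = (\<integral>\<^sup>+z. eexp (\<kappa> z v) \<partial>Q)"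
definition "mark v = (\<integral>\<^sup>+z. \<rho> z v * eexp (\<kappa> z v) \<partial>Q)"
definition "G t = (\<integral>\<^sup>+\<omega>. eexp (energy t \<omega>) \<partial>ppr_space Q)"
definition "J k t = (\<integral>\<^sup>+\<omega>. \<rho> (fst \<omega> k) (t + ppr_arrival (snd \<omega>) k)
  * eexp (energy t \<omega>) \<partial>ppr_space Q)"

sublocale \<Omega>: prob_space "ppr_space Q"
  by (rule prob_space_ppr_space) (rule prob_space_axioms)

lemma measurable_energy[measurable]:
  "(\<lambda>(t, \<omega>). energy t \<omega>) \<in> borel_measurable (borel \<Otimes>\<^sub>M ppr_space Q)"
  unfolding energy_def split_beta' by measurable

lemma measurable_wt[measurable]: "wt \<in> borel_measurable borel"
  unfolding wt_def[abs_def] by measurable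

lemma measurable_mark[measurable]: "mark \<in> borel_measurable borel"
  unfolding mark_def[abs_def] by measurable

lemma measurable_G[measurable]: "G \<in> borel_measurable borel"
  unfolding G_def[abs_def] by measurable

lemma measurable_J[measurable]: "J k \<in> borel_measurable borel"
  unfolding J_def[abs_def] by measurable

lemma energy_case_nat:
  "energy t (case_nat z (fst \<omega>), case_nat s (snd \<omega>)) = \<kappa> z (t + s) + energy (t + s) \<omega>"
  unfolding energy_def by (subst suminf_offset[where i=1]) (auto simp: add_ac)

text \<open>Condition on the first point: its factor splits off, and the other points form the same
  process started at \<open>t + s\<close>. In the next two lemmas the first point is the selected
  one, respectively lowers the selected index by one.\<close>

lemma G_iter: "G t = (\<integral>\<^sup>+s. wt (t + s) * G (t + s) \<partial>std_exponential)"
  unfolding G_def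
  by (subst nn_integral_ppr_space_iter)
     (auto simp: energy_case_nat eexp_add nn_integral_cmult nn_integral_multc wt_def
       prob_space_axioms)

lemma J_0_iter: "J 0 t = (\<integral>\<^sup>+s. mark (t + s) * G (t + s) \<partial>std_exponential)"
  unfolding G_def J_def
  by (subst nn_integral_ppr_space_iter)
     (auto simp: energy_case_nat eexp_add nn_integral_cmult nn_integral_multc mark_def
       prob_space_axioms mult.assoc[symmetric])

lemma J_Suc_iter: "J (Suc k) t = (\<integral>\<^sup>+s. wt (t + s) * J k (t + s) \<partial>std_exponential)"
  unfolding J_def
  by (subst nn_integral_ppr_space_iter)
     (auto simp: energy_case_nat eexp_add nn_integral_cmult nn_integral_multc wt_def
       prob_space_axioms mult.left_commute add.assoc)

lemma G_renewal:
  "ennreal (exp (- t)) * G t = (\<integral>\<^sup>+v. wt v * (ennreal (exp (- v)) * G v)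
    * indicator {t<..} v \<partial>lborel)"
  unfolding G_iter[of t] by (subst nn_integral_std_exponential_shift) (auto simp: mult_ac)

lemma J_0_renewal:
  "ennreal (exp (- t)) * J 0 t = (\<integral>\<^sup>+v. mark v * (ennreal (exp (- v)) * G v)
    * indicator {t<..} v \<partial>lborel)"
  unfolding J_0_iter[of t] by (subst nn_integral_std_exponential_shift) (auto simp: mult_ac)

lemma J_Suc_renewal:
  "ennreal (exp (- t)) * J (Suc k) t = (\<integral>\<^sup>+v. wt v * (ennreal (exp (- v)) * J k v)
    * indicator {t<..} v \<partial>lborel)"
  unfolding J_Suc_iter[of k t] by (subst nn_integral_std_exponential_shift) (auto simp: mult_ac)

text \<open>Given a selected point at \<open>v\<close>, the number of earlier points has Poisson
  weights with mean p = \<Phi> v - \<Phi> 0 \<le> v, whence the factor ln (1 + v). The normalisation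
  exp p times \<open>H v\<close> is at most exp (- L), where L is the integral of 1 - \<phi> over
  positive times. Since \<phi> has to equal \<open>wt\<close> on positive times only, it can be
  chosen with an antiderivative on the whole line.\<close>

lemma suminf_ln_J_le:
  fixes \<phi> \<Phi> :: "real \<Rightarrow> real"
  assumes \<Phi>: "\<And>t. DERIV \<Phi> t :> \<phi> t"
    and \<phi>[measurable]: "\<phi> \<in> borel_measurable borel" and nn: "\<And>t. 0 \<le> \<phi> t" and le1: "\<And>t. \<phi> t \<le> 1"
    and wt: "\<And>v. 0 < v \<Longrightarrow> wt v = ennreal (\<phi> v)"
    and L: "(\<lambda>n. real n - (\<Phi> (real n) - \<Phi> 0)) \<longlonglongrightarrow> L"
  shows "(\<Sum>k. ennreal (ln (real (Suc k))) * J k 0)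
      \<le> (\<integral>\<^sup>+v. mark v * ennreal (ln (1 + v)) * indicator {0<..} v \<partial>lborel) * ennreal (exp (- L))"
proof -
  define H where "H t = ennreal (exp (- t)) * G t" for t
  have [measurable]: "H \<in> borel_measurable borel" unfolding H_def[abs_def] by measurable
  have "continuous_on UNIV \<Phi>"
    using \<Phi> by (auto intro!: continuous_at_imp_continuous_on DERIV_isCont)
  then have [measurable]: "\<Phi> \<in> borel_measurable borel"
    by (rule borel_measurable_continuous_onI)
  have wt_ind: "wt v * X * indicator {t<..} v = ennreal (\<phi> v) * X * indicator {t<..} v" if "0
    \<le> t" for v t X
    using wt[of v] that by (auto simp: indicator_def)
  have J: "J k 0 = (\<integral>\<^sup>+v. ennreal ((\<Phi> v - \<Phi> 0) ^ k / fact k) * (mark v * H v)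
    * indicator {0<..} v \<partial>lborel)" for k
  proof -
    have "ennreal (exp (- 0)) * J k 0 = (\<integral>\<^sup>+v. ennreal ((\<Phi> v - \<Phi> 0) ^ k / fact k) * (mark v * H v)
      * indicator {0<..} v \<partial>lborel)"
      by (rule nn_integral_iterated_weights[where J="\<lambda>k t. ennreal (exp (- t)) * J k t", OF \<Phi> \<phi> nn])
         (auto simp: J_0_renewal J_Suc_renewal H_def wt_ind)
    then show ?thesis by simp
  qed
  have G_le_1: "G t \<le> 1" for t
  proof -
    have "G t \<le> (\<integral>\<^sup>+\<omega>. 1 \<partial>ppr_space Q)"
      unfolding G_def by (intro nn_integral_mono eexp_le_1)
    also have "\<dots> = 1" by (simp add: \<Omega>.emeasure_space_1)
    finally show ?thesis .
  qed
  \<comment> \<open>Apply \<open>renewal_subsolution_le\<close> with horizon n and let n tend to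
    infinity. The values \<Phi> v cancel in the exponent, so the limit does not depend on
    \<open>v\<close>.\<close>
  have H_le: "ennreal (exp (\<Phi> v - \<Phi> 0)) * H v \<le> ennreal (exp (- L))" if "0 < v" for v
  proof (rule tendsto_lowerbound)
    show "(\<lambda>n. ennreal (exp (- (real n - (\<Phi> (real n) - \<Phi> 0))))) \<longlonglongrightarrow> ennreal (exp (- L))"
      by (intro tendsto_ennrealI tendsto_intros L)
    show "eventually (\<lambda>n. ennreal (exp (\<Phi> v - \<Phi> 0)) * H v
      \<le> ennreal (exp (- (real n - (\<Phi> (real n) - \<Phi> 0))))) sequentially"
    proof (rule eventually_sequentiallyI)
      fix n assume n: "nat \<lceil>v\<rceil> \<le> n"
      have "H v \<le> ennreal (exp (\<Phi> (real n) - real n - \<Phi> v))"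
      proof (rule renewal_subsolution_le[OF \<Phi> \<phi> nn le1])
        show "H t \<le> ennreal (exp (- t))" for t
          unfolding H_def using mult_left_mono[OF G_le_1[of t], of "ennreal (exp (- t))"] by simp
        show "H t \<le> (\<integral>\<^sup>+v. ennreal (\<phi> v) * H v * indicator {t<..} v \<partial>lborel)" if "0 \<le> t" for t
          unfolding H_def by (subst G_renewal) (simp add: wt_ind that)
      qed (use n that in linarith)+
      then have "ennreal (exp (\<Phi> v - \<Phi> 0)) * H v \<le> ennreal (exp (\<Phi> v - \<Phi> 0))
        * ennreal (exp (\<Phi> (real n) - real n - \<Phi> v))"
        by (rule mult_left_mono) simp
      also have "\<dots> = ennreal (exp (- (real n - (\<Phi> (real n) - \<Phi> 0))))"
        by (simp add: ennreal_mult'[symmetric] exp_add[symmetric] algebra_simps)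
      finally show "ennreal (exp (\<Phi> v - \<Phi> 0)) * H v
        \<le> ennreal (exp (- (real n - (\<Phi> (real n) - \<Phi> 0))))" .
    qed
  qed simp
  have "(\<Sum>k. ennreal (ln (real (Suc k))) * J k 0)
      = (\<integral>\<^sup>+v. (\<Sum>k. ennreal (ln (real (Suc k))) * (ennreal ((\<Phi> v - \<Phi> 0) ^ k / fact k) * (mark v
        * H v) * indicator {0<..} v)) \<partial>lborel)"
    by (simp add: J nn_integral_suminf nn_integral_cmult)
  also have "\<dots> \<le> (\<integral>\<^sup>+v. mark v * ennreal (ln (1 + v)) * indicator {0<..} v
    * ennreal (exp (- L)) \<partial>lborel)"
  proof (intro nn_integral_mono)
    fix v :: real
    show "(\<Sum>k. ennreal (ln (real (Suc k))) * (ennreal ((\<Phi> v - \<Phi> 0) ^ k / fact k) * (mark v * H v)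
      * indicator {0<..} v))
       \<le> mark v * ennreal (ln (1 + v)) * indicator {0<..} v * ennreal (exp (- L))"
    proof (cases "0 < v")
      case True
      define p where "p = \<Phi> v - \<Phi> 0"
      \<comment> \<open>The mean value theorem turns 0 \<le> \<phi> \<le> 1 into 0 \<le> p \<le>
        v.\<close>
      have "\<exists>z>0. z < v \<and> \<Phi> v - \<Phi> 0 = (v - 0) * \<phi> z"
        using True \<Phi> by (intro MVT2) auto
      then obtain z where "\<Phi> v - \<Phi> 0 = v * \<phi> z" by auto
      then have p: "0 \<le> p" "p \<le> v"
        using True nn[of z] mult_left_mono[OF le1[of z], of v] by (auto simp: p_def)
      have "(\<Sum>k. ennreal (ln (real (Suc k))) * (ennreal (p ^ k / fact k) * (mark v * H v)))
          = (\<Sum>k. ennreal (ln (real (Suc k))) * ennreal (p ^ k / fact k)) * (mark v * H v)"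
        by (simp add: ennreal_suminf_multc[symmetric] mult.assoc)
      also have "\<dots> \<le> ennreal (exp p * ln (1 + p)) * (mark v * H v)"
        by (intro mult_right_mono suminf_ln_power_le p) simp
      also have "\<dots> \<le> ennreal (exp p * ln (1 + v)) * (mark v * H v)"
        using p True by (intro mult_right_mono ennreal_leI mult_left_mono) auto
      also have "\<dots> = mark v * ennreal (ln (1 + v)) * (ennreal (exp p) * H v)"
        using True by (simp add: ennreal_mult mult_ac)
      also have "\<dots> \<le> mark v * ennreal (ln (1 + v)) * ennreal (exp (- L))"
        using H_le[OF True] by (intro mult_left_mono) (auto simp: p_def)
      finally show ?thesis using True by (simp add: p_def)
    qed simp
  qed
  also have "\<dots> = (\<integral>\<^sup>+v. mark v * ennreal (ln (1 + v)) * indicator {0<..} v \<partial>lborel)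
    * ennreal (exp (- L))"
    by (rule nn_integral_multc) measurable
  finally show ?thesis .
qed

end

section \<open>The scores of the Poisson private representation\<close>

lemma nn_integral_powr_exp:
  fixes \<eta> l :: real
  assumes "-1 < \<eta>" "0 < l"
  shows "(\<integral>\<^sup>+s. ennreal (s powr \<eta> * exp (- (l * s))) * indicator {0<..} s \<partial>lborel)
       = ennreal (Gamma (\<eta> + 1) / l powr (\<eta> + 1))"
proof -
  have "ennreal (Gamma (\<eta> + 1)) = (\<integral>\<^sup>+t. ennreal (indicator {0..} t * t powr (\<eta>
    + 1 - 1) / exp t) \<partial>lborel)"
    using assms by (intro Gamma_conv_nn_integral_real) auto
  also have "\<dots> = (\<integral>\<^sup>+t. ennreal (t powr \<eta> * exp (- t)) * indicator {0<..} t \<partial>lborel)"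
    using AE_lborel_singleton[of 0]
    by (intro nn_integral_cong_AE, eventually_elim) (auto simp: indicator_def exp_minus field_simps)
  also have "\<dots> = ennreal l * (\<integral>\<^sup>+s. ennreal ((l * s) powr \<eta> * exp (- (l * s))) * indicator {0<..} (l
    * s) \<partial>lborel)"
    using assms by (subst nn_integral_real_affine[where c=l and t=0]) auto
  also have "(\<integral>\<^sup>+s. ennreal ((l * s) powr \<eta> * exp (- (l * s))) * indicator {0<..} (l * s) \<partial>lborel)
      = (\<integral>\<^sup>+s. ennreal (l powr \<eta>) * (ennreal (s powr \<eta> * exp (- (l * s)))
        * indicator {0<..} s) \<partial>lborel)"
    using assms by (intro nn_integral_cong)
      (auto simp: indicator_def powr_mult ennreal_mult'[symmetric] zero_less_mult_iff mult.assoc)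
  also have "\<dots> = ennreal (l powr \<eta>) * (\<integral>\<^sup>+s. ennreal (s powr \<eta> * exp (- (l * s)))
    * indicator {0<..} s \<partial>lborel)"
    by (rule nn_integral_cmult) measurable
  finally have eq: "ennreal (Gamma (\<eta> + 1)) = ennreal (l powr (\<eta> + 1)) * (\<integral>\<^sup>+s. ennreal (s powr \<eta>
    * exp (- (l * s))) * indicator {0<..} s \<partial>lborel)"
    using assms by (simp add: powr_add ennreal_mult mult_ac)
  have "ennreal (Gamma (\<eta> + 1) / l powr (\<eta> + 1)) = ennreal (1 / l powr (\<eta> + 1)) * ennreal (Gamma (\<eta>
    + 1))"
    by (subst ennreal_mult'[symmetric]) auto
  also have "\<dots> = ennreal (1 / l powr (\<eta> + 1) * l powr (\<eta> + 1)) * (\<integral>\<^sup>+s. ennreal (s powr \<eta>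
    * exp (- (l * s))) * indicator {0<..} s \<partial>lborel)"
    unfolding eq by (subst ennreal_mult) (auto simp: mult.assoc)
  also have "1 / l powr (\<eta> + 1) * l powr (\<eta> + 1) = 1" using assms by simp
  finally show ?thesis by simp
qed

text \<open>Describes a superlevel set of the score in time as an interval, for the layer-cake
  argument in \<open>nn_integral_one_minus_exp\<close>.\<close>

lemma le_powr_scaled_iff:
  fixes a t w x \<alpha> :: real
  assumes "0 < a" "0 < t" "0 < w" "0 < x" "0 < \<alpha>"
  shows "w \<le> x * (a / t) powr \<alpha> \<longleftrightarrow> t \<le> a * (x / w) powr (1 / \<alpha>)"
proof -
  have "w \<le> x * (a / t) powr \<alpha> \<longleftrightarrow> t powr \<alpha> \<le> a powr \<alpha> * (x / w)"
    using assms by (simp add: powr_divide field_simps)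
  also have "a powr \<alpha> * (x / w) = (a * (x / w) powr (1 / \<alpha>)) powr \<alpha>"
    using assms by (simp add: powr_mult powr_powr)
  also have "t powr \<alpha> \<le> (a * (x / w) powr (1 / \<alpha>)) powr \<alpha> \<longleftrightarrow> t \<le> a * (x / w) powr (1 / \<alpha>)"
    using assms powr_mono2[of \<alpha> t "a * (x / w) powr (1 / \<alpha>)"] powr_less_mono2[of \<alpha> "a
      * (x / w) powr (1 / \<alpha>)" t]
    by (cases "t \<le> a * (x / w) powr (1 / \<alpha>)") auto
  finally show ?thesis .
qed

text \<open>Write 1 - exp (- y) as the integral of exp (- w) over w \<le> y and exchange the
  integrals. For fixed w the admissible t form an interval of length a (x/w)^(1/\<alpha>), which
  leaves a Gamma integral with exponent -1/\<alpha> > -1.\<close>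

lemma nn_integral_one_minus_exp:
  fixes a x \<alpha> :: real
  assumes "0 < a" "0 < x" "1 < \<alpha>"
  shows "(\<integral>\<^sup>+t. ennreal (1 - exp (- (x * (a / t) powr \<alpha>))) * indicator {0<..} t \<partial>lborel)
       = ennreal (a * x powr (1 / \<alpha>) * Gamma (1 - 1 / \<alpha>))"
proof -
  have "(\<integral>\<^sup>+t. ennreal (1 - exp (- (x * (a / t) powr \<alpha>))) * indicator {0<..} t \<partial>lborel)
     = (\<integral>\<^sup>+t. (\<integral>\<^sup>+w. ennreal (exp (- w)) * indicator {0<..} w * indicator {0<..} t * (if w
       \<le> x * (a / t) powr \<alpha> then 1 else 0) \<partial>lborel) \<partial>lborel)"
  proof (intro nn_integral_cong)
    fix t :: real
    define y where "y = x * (a / t) powr \<alpha>"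
    have y: "0 \<le> y" using assms by (simp add: y_def)
    have "(\<integral>\<^sup>+w. ennreal (exp (- w)) * indicator {0<..} w * (if w \<le> y then 1 else 0) \<partial>lborel)
       = (\<integral>\<^sup>+w. ennreal (exp (- w)) * indicator {0..y} w \<partial>lborel)"
      using AE_lborel_singleton[of 0]
        by (intro nn_integral_cong_AE, eventually_elim) (auto simp: indicator_def)
    also have "\<dots> = ennreal (- exp (- y) - (- exp (- 0)))"
      by (rule nn_integral_FTC_Icc) (use y in \<open>auto intro!: derivative_eq_intros\<close>)
    finally show "ennreal (1 - exp (- (x * (a / t) powr \<alpha>))) * indicator {0<..} t
       = (\<integral>\<^sup>+w. ennreal (exp (- w)) * indicator {0<..} w * indicator {0<..} t * (if w
         \<le> x * (a / t) powr \<alpha> then 1 else 0) \<partial>lborel)"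
      by (cases "0 < t") (auto simp: y_def)
  qed
  also have "\<dots> = (\<integral>\<^sup>+w. (\<integral>\<^sup>+t. ennreal (exp (- w)) * indicator {0<..} w * indicator {0<..} t * (if w
    \<le> x * (a / t) powr \<alpha> then 1 else 0) \<partial>lborel) \<partial>lborel)"
    by (rule lborel_pair.Fubini') measurable
  also have "\<dots> = (\<integral>\<^sup>+w. ennreal (a * x powr (1 / \<alpha>)) * (ennreal (w powr (- 1 / \<alpha>) * exp (- (1 * w)))
    * indicator {0<..} w) \<partial>lborel)"
  proof (intro nn_integral_cong)
    fix w :: real
    show "(\<integral>\<^sup>+t. ennreal (exp (- w)) * indicator {0<..} w * indicator {0<..} t * (if w
      \<le> x * (a / t) powr \<alpha> then 1 else 0) \<partial>lborel)
       = ennreal (a * x powr (1 / \<alpha>)) * (ennreal (w powr (- 1 / \<alpha>) * exp (- (1 * w)))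
         * indicator {0<..} w)"
    proof (cases "0 < w")
      case True
      define T where "T = a * (x / w) powr (1 / \<alpha>)"
      have iff: "w \<le> x * (a / t) powr \<alpha> \<longleftrightarrow> t \<le> T" if "0 < t" for t
        unfolding T_def using True assms that by (intro le_powr_scaled_iff) auto
      have "(\<integral>\<^sup>+t. ennreal (exp (- w)) * indicator {0<..} w * indicator {0<..} t * (if w
        \<le> x * (a / t) powr \<alpha> then 1 else 0) \<partial>lborel)
         = (\<integral>\<^sup>+t. ennreal (exp (- w)) * indicator {0<..T} t \<partial>lborel)"
        using True assms by (intro nn_integral_cong) (auto simp: indicator_def iff)
      also have "\<dots> = ennreal (exp (- w)) * ennreal T"
        using assms True by (simp add: nn_integral_cmult_indicator T_def)
      also have "T = a * x powr (1 / \<alpha>) * w powr (- 1 / \<alpha>)"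
        using True assms by (simp add: T_def powr_divide powr_minus_divide)
      also have "ennreal (exp (- w)) * ennreal (a * x powr (1 / \<alpha>) * w powr (- 1 / \<alpha>))
          = ennreal (a * x powr (1 / \<alpha>)) * ennreal (w powr (- 1 / \<alpha>) * exp (- (1 * w)))"
        using assms by (simp add: ennreal_mult mult_ac)
      finally show ?thesis using True by simp
    qed simp
  qed
  also have "\<dots> = ennreal (a * x powr (1 / \<alpha>)) * (\<integral>\<^sup>+w. ennreal (w powr (- 1 / \<alpha>) * exp (- (1 * w)))
    * indicator {0<..} w \<partial>lborel)"
    by (rule nn_integral_cmult) measurable
  also have "(\<integral>\<^sup>+w. ennreal (w powr (- 1 / \<alpha>) * exp (- (1 * w))) * indicator {0<..} w \<partial>lborel)
     = ennreal (Gamma (- 1 / \<alpha> + 1) / 1 powr (- 1 / \<alpha> + 1))"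
    using assms by (intro nn_integral_powr_exp) auto
  finally show ?thesis using assms by (simp add: ennreal_mult'[symmetric])
qed

text \<open>Combines (1 + y)^\<eta> \<le> 1 + y^\<eta> with the tangent to \<open>ln\<close> at
  \<open>A\<close>. The result is affine in s^\<eta>, so averaging over \<Theta> needs one moment
  only; \<open>A\<close> will be 1 + E[\<Theta>^\<eta>].\<close>

lemma ln_one_plus_le_tangent:
  fixes a s A \<eta> :: real
  assumes "0 < a" "0 < s" "0 < A" "0 < \<eta>" "\<eta> \<le> 1"
  shows "ln (1 + a * s) \<le> ln a + (ln A + (a powr (- \<eta>) + s powr \<eta>) / A - 1) / \<eta>"
proof -
  define y where "y = a * s"
  have q: "0 < a powr (- \<eta>) + s powr \<eta>" using assms by (intro add_pos_pos) auto
  have y: "0 < y" using assms by (simp add: y_def)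
  \<comment> \<open>Applied to 1 / (1 + y) and y / (1 + y), which add up to 1, this gives the
    subadditivity of the power.\<close>
  have frac: "p \<le> p powr \<eta>" if "0 < p" "p \<le> 1" for p :: real
    using powr_mono'[of \<eta> 1 p] that assms by simp
  have "1 = 1 / (1 + y) + y / (1 + y)" using y by (simp add: add_divide_distrib[symmetric])
  also have "\<dots> \<le> (1 / (1 + y)) powr \<eta> + (y / (1 + y)) powr \<eta>"
    using y by (intro add_mono frac) auto
  also have "\<dots> = (1 + y powr \<eta>) / (1 + y) powr \<eta>"
    using y by (simp add: powr_divide add_divide_distrib)
  finally have "(1 + y) powr \<eta> \<le> 1 + y powr \<eta>"
    using y by (simp add: field_simps)
  then have "ln ((1 + y) powr \<eta>) \<le> ln (1 + y powr \<eta>)"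
    using y by (subst ln_le_cancel_iff) (auto intro: add_pos_nonneg)
  also have "1 + y powr \<eta> = a powr \<eta> * (a powr (- \<eta>) + s powr \<eta>)"
    using assms by (simp add: y_def powr_mult powr_minus field_simps)
  also have "ln \<dots> = \<eta> * ln a + ln (a powr (- \<eta>) + s powr \<eta>)"
    using assms q by (simp add: ln_mult ln_powr)
  also have "ln (a powr (- \<eta>) + s powr \<eta>) = ln A + ln ((a powr (- \<eta>) + s powr \<eta>) / A)"
    using assms q by (simp add: ln_div)
  also have "ln ((a powr (- \<eta>) + s powr \<eta>) / A) \<le> (a powr (- \<eta>) + s powr \<eta>) / A - 1"
    using assms by (intro ln_le_minus_one divide_pos_pos add_pos_pos) auto
  finally have "\<eta> * ln (1 + y) \<le> \<eta> * ln a + (ln A + ((a powr (- \<eta>) + s powr \<eta>) / A - 1))"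
    using y by (simp add: ln_powr)
  then have "ln (1 + y) \<le> (\<eta> * ln a + (ln A + ((a powr (- \<eta>) + s powr \<eta>) / A - 1))) / \<eta>"
    using assms by (simp add: pos_le_divide_eq mult.commute)
  also have "\<dots> = ln a + (ln A + (a powr (- \<eta>) + s powr \<eta>) / A - 1) / \<eta>"
    using assms by (simp add: add_divide_distrib diff_divide_distrib)
  finally show ?thesis by (simp add: y_def)
qed

text \<open>Weighted arithmetic-geometric mean of 1 / a and 1. The right-hand side is affine in 1 /
  a, whose average is controlled when a = g(Z) with Z of law \<open>P\<close>.\<close>

lemma powr_minus_le_affine:
  fixes a \<eta> :: real
  assumes "0 < a" "0 < \<eta>" "\<eta> \<le> 1"
  shows "a powr (- \<eta>) \<le> \<eta> / a + (1 - \<eta>)"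
  using Youngs_inequality_0[of \<eta> "1 - \<eta>" "1 / a" 1] assms
  by (simp add: powr_divide powr_minus_divide)

section \<open>The averaged kernel of the scores and its antiderivative\<close>

locale ppr_target = prob_space Q for Q :: "'a measure" +
  fixes g :: "'a \<Rightarrow> real" and \<alpha> :: real
  assumes g[measurable]: "g \<in> borel_measurable Q" and g_nonneg: "\<And>z. 0 \<le> g z"
    and g_integral: "(\<integral>\<^sup>+z. ennreal (g z) \<partial>Q) = 1" and \<alpha>: "1 < \<alpha>"
begin

abbreviation "c \<equiv> Gamma (1 - 1 / \<alpha>)"

lemma c_pos: "0 < c"
  using \<alpha> by (intro Gamma_real_pos) auto

text \<open>Extended to \<open>t \<le> 0\<close> by its limit at \<open>0\<close>, so that \<open>\<phi>\<close> is continuous on the whole line.\<close>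
definition kern :: "real \<Rightarrow> 'a \<Rightarrow> real \<Rightarrow> real" where
  "kern x z t = (if g z = 0 then 1 else if t \<le> 0 then 0 else exp (- (x * (g z / t) powr \<alpha>)))"

lemma kern_bounds: "0 < x \<Longrightarrow> 0 \<le> kern x z t" "0 < x \<Longrightarrow> kern x z t \<le> 1"
  by (auto simp: kern_def)

lemma measurable_kern[measurable]: "(\<lambda>(z, t). kern x z t) \<in> borel_measurable (Q \<Otimes>\<^sub>M borel)"
  unfolding kern_def split_beta' by measurable

text \<open>Only t = 0 with g z > 0 is delicate: from the right the exponent tends to minus
  infinity, matching the value 0 on the left.\<close>

lemma isCont_kern: 
  assumes "0 < x" shows "isCont (kern x z) t"
proof (cases "g z = 0")
  case True
  then show ?thesis by (simp add: kern_def[abs_def])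
next
  case False
  then have g: "0 < g z" using g_nonneg[of z] by simp
  let ?f = "\<lambda>t. exp (- (x * (g z / t) powr \<alpha>))"
  have kern: "kern x z = (\<lambda>t. if t \<le> 0 then 0 else ?f t)"
    using False by (auto simp: kern_def)
  consider "t < 0" | "t = 0" | "0 < t" by linarith
  then show ?thesis
  proof cases
    case 1
    have "eventually (\<lambda>t. kern x z t = 0) (nhds t)"
      using 1 by (intro eventually_nhds_in_open[of "{..<0}" t, THEN eventually_mono]) (auto simp:
        kern)
    then show ?thesis by (subst isCont_cong[where g="\<lambda>_. 0"]) auto
  next
    case 3
    have "eventually (\<lambda>t. kern x z t = ?f t) (nhds t)"
      using 3 by (intro eventually_nhds_in_open[of "{0<..}" t, THEN eventually_mono]) (auto simp:
        kern)
    moreover have "isCont ?f t" using 3 g by (intro continuous_intros) auto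
    ultimately show ?thesis by (subst isCont_cong[where g="?f"]) auto
  next
    case 2
    have "(?f \<longlongrightarrow> 0) (at_right 0)" using g assms \<alpha> by real_asymp
    then have "(kern x z \<longlongrightarrow> 0) (at_right 0)"
      by (rule Lim_transform_eventually) (auto simp: kern eventually_at_filter)
    moreover have "(kern x z \<longlongrightarrow> 0) (at_left 0)"
      by (rule Lim_transform_eventually[of "\<lambda>_. 0"]) (auto simp: kern eventually_at_filter)
    ultimately show ?thesis
      unfolding isCont_def 2 by (subst filterlim_at_split) (auto simp: kern)
  qed
qed

definition "\<phi> x t = (\<integral>z. kern x z t \<partial>Q)"

lemma integrable_kern: "0 < x \<Longrightarrow> integrable Q (\<lambda>z. kern x z t)"
  by (rule integrable_const_bound[where B=1]) (auto simp: kern_bounds)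

lemma \<phi>_bounds: 
  assumes "0 < x" shows "0 \<le> \<phi> x t" "\<phi> x t \<le> 1"
  unfolding \<phi>_def using kern_bounds[OF assms]
  by (auto intro!: integral_nonneg_AE integral_le_const integrable_kern assms)

lemma isCont_\<phi>:
  assumes "0 < x" shows "isCont (\<phi> x) t"
proof -
  have "(\<lambda>n. \<phi> x (u n)) \<longlonglongrightarrow> \<phi> x t" if "u \<longlonglongrightarrow> t" for u
    unfolding \<phi>_def
  proof (rule integral_dominated_convergence[where w="\<lambda>_. 1"])
    show "AE z in Q. (\<lambda>n. kern x z (u n)) \<longlonglongrightarrow> kern x z t"
      using isCont_tendsto_compose[OF isCont_kern[OF assms] that] by auto
  qed (use kern_bounds[OF assms] in auto)
  then show ?thesis
    unfolding continuous_at_sequentially by (auto simp: o_def)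
qed

lemma measurable_\<phi>: "0 < x \<Longrightarrow> \<phi> x \<in> borel_measurable borel"
  by (intro borel_measurable_continuous_onI continuous_at_imp_continuous_on) (auto intro: isCont_\<phi>)

text \<open>For each mark the time integral is proportional to \<open>g z\<close>, and
  \<open>g\<close> has mean 1 under \<open>Q\<close>. Hence the result no longer depends on the
  target.\<close>

lemma nn_integral_one_minus_\<phi>:
  assumes x: "0 < x"
  shows "(\<integral>\<^sup>+t. ennreal (1 - \<phi> x t) * indicator {0<..} t \<partial>lborel) = ennreal (c * x powr (1 / \<alpha>))"
proof -
  interpret Ql: pair_sigma_finite Q lborel ..
  have "(\<integral>\<^sup>+t. ennreal (1 - \<phi> x t) * indicator {0<..} t \<partial>lborel)
     = (\<integral>\<^sup>+t. (\<integral>\<^sup>+z. ennreal (1 - kern x z t) * indicator {0<..} t \<partial>Q) \<partial>lborel)"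
  proof (intro nn_integral_cong)
    fix t :: real
    have "ennreal (1 - \<phi> x t) = ennreal (\<integral>z. 1 - kern x z t \<partial>Q)"
      using integrable_kern[OF x, of t] by (simp add: \<phi>_def prob_space)
    also have "\<dots> = (\<integral>\<^sup>+z. ennreal (1 - kern x z t) \<partial>Q)"
      using integrable_kern[OF x, of t] kern_bounds[OF x]
      by (intro nn_integral_eq_integral[symmetric]) auto
    finally show "ennreal (1 - \<phi> x t) * indicator {0<..} t = (\<integral>\<^sup>+z. ennreal (1 - kern x z t)
      * indicator {0<..} t \<partial>Q)"
      by (simp add: nn_integral_multc)
  qed
  also have "\<dots> = (\<integral>\<^sup>+z. (\<integral>\<^sup>+t. ennreal (1 - kern x z t) * indicator {0<..} t \<partial>lborel) \<partial>Q)"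
    by (rule Ql.Fubini') measurable
  also have "\<dots> = (\<integral>\<^sup>+z. ennreal (g z) * ennreal (c * x powr (1 / \<alpha>)) \<partial>Q)"
  proof (intro nn_integral_cong)
    fix z
    show "(\<integral>\<^sup>+t. ennreal (1 - kern x z t) * indicator {0<..} t \<partial>lborel) = ennreal (g z) * ennreal (c
      * x powr (1 / \<alpha>))"
    proof (cases "g z = 0")
      case True
      then show ?thesis by (simp add: kern_def)
    next
      case False
      then have g: "0 < g z" using g_nonneg[of z] by simp
      have "(\<integral>\<^sup>+t. ennreal (1 - kern x z t) * indicator {0<..} t \<partial>lborel)
         = (\<integral>\<^sup>+t. ennreal (1 - exp (- (x * (g z / t) powr \<alpha>))) * indicator {0<..} t \<partial>lborel)"
        using False by (intro nn_integral_cong) (auto simp: kern_def indicator_def)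
      also have "\<dots> = ennreal (g z * x powr (1 / \<alpha>) * c)"
        by (rule nn_integral_one_minus_exp[OF g x \<alpha>])
      finally show ?thesis using g by (simp add: ennreal_mult'[symmetric] mult_ac)
    qed
  qed
  also have "\<dots> = ennreal (c * x powr (1 / \<alpha>))"
    by (simp add: nn_integral_multc g_integral)
  finally show ?thesis .
qed

text \<open>Continuity of \<phi> gives an antiderivative on the whole line. The deficit n - (\<Phi>
  n - \<Phi> 0) is the integral of 1 - \<phi> over [0, n], so monotone convergence yields its
  limit.\<close>

lemma exists_\<Phi>:
  assumes x: "0 < x"
  obtains \<Phi> where "\<And>t. DERIV \<Phi> t :> \<phi> x t"
    and "(\<lambda>n. real n - (\<Phi> (real n) - \<Phi> 0)) \<longlonglongrightarrow> c * x powr (1 / \<alpha>)"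
proof -
  have "\<exists>F. \<forall>t. - \<infinity> < ereal t \<longrightarrow> ereal t < \<infinity> \<longrightarrow> (F has_vector_derivative \<phi> x t) (at t)"
    by (rule einterval_antiderivative) (auto intro: isCont_\<phi> x)
  then obtain \<Phi> where \<Phi>: "\<And>t. DERIV \<Phi> t :> \<phi> x t"
    by (auto simp: has_real_derivative_iff_has_vector_derivative)
  note [measurable] = measurable_\<phi>[OF x]
  have eq: "(\<integral>\<^sup>+t. ennreal (1 - \<phi> x t) * indicator {0..real n} t \<partial>lborel)
    = ennreal ((real n - \<Phi> (real n)) - (0 - \<Phi> 0))" for n
    by (rule nn_integral_FTC_Icc) (use \<phi>_bounds[OF x] in \<open>auto intro!: derivative_eq_intros \<Phi>\<close>)
  have "(\<lambda>n. \<integral>\<^sup>+t. ennreal (1 - \<phi> x t) * indicator {0..real n} t \<partial>lborel)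
      \<longlonglongrightarrow> (\<integral>\<^sup>+t. ennreal (1 - \<phi> x t) * indicator {0..} t \<partial>lborel)"
  proof (rule nn_integral_LIMSEQ)
    show "incseq (\<lambda>n t. ennreal (1 - \<phi> x t) * indicator {0..real n} t)"
      by (auto simp: incseq_def le_fun_def indicator_def)
    show "(\<lambda>n. ennreal (1 - \<phi> x t) * indicator {0..real n} t)
      \<longlonglongrightarrow> ennreal (1 - \<phi> x t) * indicator {0..} t" for t
    proof (rule tendsto_eventually, rule eventually_sequentiallyI)
      fix n assume "nat \<lceil>t\<rceil> \<le> n"
      then have "t \<le> real n" by linarith
      then show "ennreal (1 - \<phi> x t) * indicator {0..real n} t
        = ennreal (1 - \<phi> x t) * indicator {0..} t"
        by (auto simp: indicator_def)
    qed
  qed auto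
  also have "(\<integral>\<^sup>+t. ennreal (1 - \<phi> x t) * indicator {0..} t \<partial>lborel) = (\<integral>\<^sup>+t. ennreal (1 - \<phi> x t)
    * indicator {0<..} t \<partial>lborel)"
    using AE_lborel_singleton[of 0]
      by (intro nn_integral_cong_AE, eventually_elim) (auto simp: indicator_def)
  also have "\<dots> = ennreal (c * x powr (1 / \<alpha>))" by (rule nn_integral_one_minus_\<phi>[OF x])
  finally have "(\<lambda>n. ennreal ((real n - \<Phi> (real n)) - (0 - \<Phi> 0))) \<longlonglongrightarrow> ennreal (c * x powr (1 / \<alpha>))"
    unfolding eq .
  \<comment> \<open>Nonnegativity lets the limit in \<open>ennreal\<close> be read as a limit of
    reals.\<close>
  moreover have "0 \<le> (real n - \<Phi> (real n)) - (0 - \<Phi> 0)" for n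
  proof -
    have "0 - \<Phi> 0 \<le> real n - \<Phi> (real n)"
      using \<phi>_bounds[OF x]
      by (intro DERIV_nonneg_imp_nondecreasing[of 0 "real n" "\<lambda>t. t - \<Phi> t"])
         (auto intro!: exI[of _ "1 - \<phi> x _"] derivative_eq_intros \<Phi>)
    then show ?thesis by simp
  qed
  ultimately have "(\<lambda>n. (real n - \<Phi> (real n)) - (0 - \<Phi> 0)) \<longlonglongrightarrow> c * x powr (1 / \<alpha>)"
    using c_pos by (intro tendsto_ennrealD) auto
  then have "(\<lambda>n. real n - (\<Phi> (real n) - \<Phi> 0)) \<longlonglongrightarrow> c * x powr (1 / \<alpha>)"
    by (simp add: algebra_simps)
  with \<Phi> that show ?thesis by blast
qed

text \<open>The density of \<open>\<Theta>\<close>: the integral of \<open>s\<^bsup>-\<alpha>\<^esup> exp (-x s\<^bsup>-\<alpha>\<^esup> - c x\<^bsup>1/\<alpha>\<^esup>)\<close> over \<open>x > 0\<close> after the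
  substitution \<open>x = w s\<^sup>\<alpha>\<close>.\<close>
definition hdens :: "real \<Rightarrow> ennreal" where
  "hdens s = (\<integral>\<^sup>+w. ennreal (exp (- w) * exp (- (c * w powr (1 / \<alpha>) * s)))
    * indicator {0<..} w \<partial>lborel)"

lemma measurable_hdens[measurable]: "hdens \<in> borel_measurable borel"
  unfolding hdens_def[abs_def] by measurable

text \<open>After exchanging the integrals, the one over \<open>s\<close> is a Gamma integral with
  rate c w^(1/\<alpha>). The one over \<open>w\<close> then has exponent -(\<eta>+1)/\<alpha>, which
  exceeds -1 exactly because \<eta> < \<alpha> - 1.\<close>

lemma hdens_moment:
  assumes "0 \<le> \<eta>" "\<eta> < \<alpha> - 1"
  shows "(\<integral>\<^sup>+s. hdens s * ennreal (s powr \<eta>) * indicator {0<..} s \<partial>lborel)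
    = ennreal (ppr_const \<alpha> \<eta>)"
proof -
  let ?f = "\<lambda>s w. ennreal (s powr \<eta> * exp (- (c * w powr (1 / \<alpha>) * s))) * indicator {0<..} s
    * (ennreal (exp (- w)) * indicator {0<..} w)"
  have "(\<integral>\<^sup>+s. hdens s * ennreal (s powr \<eta>) * indicator {0<..} s \<partial>lborel)
    = (\<integral>\<^sup>+s. (\<integral>\<^sup>+w. ?f s w \<partial>lborel) \<partial>lborel)"
    unfolding hdens_def
    by (subst nn_integral_multc[symmetric], measurable, subst nn_integral_multc[symmetric],
      measurable, intro nn_integral_cong)
       (simp add: ennreal_mult mult_ac)
  also have "\<dots> = (\<integral>\<^sup>+w. (\<integral>\<^sup>+s. ?f s w \<partial>lborel) \<partial>lborel)"
    by (rule lborel_pair.Fubini') measurable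
  also have "\<dots> = (\<integral>\<^sup>+w. ennreal (Gamma (\<eta> + 1) / c powr (\<eta> + 1)) * (ennreal (w powr (- ((\<eta>
    + 1) / \<alpha>)) * exp (- (1 * w))) * indicator {0<..} w) \<partial>lborel)"
  proof (intro nn_integral_cong)
    fix w :: real
    show "(\<integral>\<^sup>+s. ?f s w \<partial>lborel) = ennreal (Gamma (\<eta> + 1) / c powr (\<eta> + 1))
      * (ennreal (w powr (- ((\<eta> + 1) / \<alpha>)) * exp (- (1 * w))) * indicator {0<..} w)"
    proof (cases "0 < w")
      case True
      have "(\<integral>\<^sup>+s. ?f s w \<partial>lborel)
          = (\<integral>\<^sup>+s. ennreal (s powr \<eta> * exp (- (c * w powr (1 / \<alpha>) * s)))
            * indicator {0<..} s \<partial>lborel) * (ennreal (exp (- w)) * indicator {0<..} w)"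
        by (rule nn_integral_multc) measurable
      also have "(\<integral>\<^sup>+s. ennreal (s powr \<eta> * exp (- (c * w powr (1 / \<alpha>) * s)))
        * indicator {0<..} s \<partial>lborel)
          = ennreal (Gamma (\<eta> + 1) / (c * w powr (1 / \<alpha>)) powr (\<eta> + 1))"
        using assms True c_pos by (intro nn_integral_powr_exp) auto
      also have "Gamma (\<eta> + 1) / (c * w powr (1 / \<alpha>)) powr (\<eta> + 1) = Gamma (\<eta> + 1) / c powr (\<eta> + 1)
        * w powr (- ((\<eta> + 1) / \<alpha>))"
        using c_pos True by (simp add: powr_mult powr_powr powr_minus_divide)
      finally show ?thesis using True assms
        by (simp add: ennreal_mult[symmetric] mult.assoc Gamma_real_nonneg)
    qed simp
  qed
  also have "\<dots> = ennreal (Gamma (\<eta> + 1) / c powr (\<eta> + 1)) * (\<integral>\<^sup>+w. ennreal (w powr (- ((\<eta> + 1) / \<alpha>))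
    * exp (- (1 * w))) * indicator {0<..} w \<partial>lborel)"
    by (rule nn_integral_cmult) measurable
  also have "(\<integral>\<^sup>+w. ennreal (w powr (- ((\<eta> + 1) / \<alpha>)) * exp (- (1 * w)))
    * indicator {0<..} w \<partial>lborel)
     = ennreal (Gamma (- ((\<eta> + 1) / \<alpha>) + 1) / 1 powr (- ((\<eta> + 1) / \<alpha>) + 1))"
    using assms \<alpha> by (intro nn_integral_powr_exp) (auto simp: field_simps)
  also have "ennreal (Gamma (\<eta> + 1) / c powr (\<eta> + 1)) * \<dots> = ennreal (ppr_const \<alpha> \<eta>)"
    using assms by (simp add: ppr_const_def ennreal_mult'[symmetric] Gamma_real_nonneg mult_ac)
  finally show ?thesis .
qed

section \<open>From the scores to a bound on the expected logarithm of the index\<close>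

abbreviation "score z t \<equiv> (g z / t) powr \<alpha>"

lemma marked_poisson_score:
  "marked_poisson Q (\<lambda>z t. ennreal (x * score z t)) (\<lambda>z t. ennreal (score z t))"
  by unfold_locales (simp_all add: split_beta')

abbreviation "J x \<equiv> marked_poisson.J Q (\<lambda>z t. ennreal (x * score z t)) (\<lambda>z t. ennreal (score z t))"

definition "total_score \<omega> = (\<Sum>i. ennreal (ppr_score \<alpha> g (fst \<omega>) (snd \<omega>) i))"

lemma measurable_score[measurable]:
  "(\<lambda>\<omega>. ppr_score \<alpha> g (fst \<omega>) (snd \<omega>) i) \<in> borel_measurable (ppr_space Q)"
  unfolding ppr_score_def by measurable

lemma measurable_total_score[measurable]: "total_score \<in> borel_measurable (ppr_space Q)"
  unfolding total_score_def[abs_def] by measurable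

lemma J_eq:
  assumes "0 < x"
  shows "J x k 0 = (\<integral>\<^sup>+\<omega>. ennreal (ppr_score \<alpha> g (fst \<omega>) (snd \<omega>) k) * eexp (ennreal x
    * total_score \<omega>) \<partial>ppr_space Q)"
proof -
  interpret M: marked_poisson Q "\<lambda>z t. ennreal (x * score z t)" "\<lambda>z t. ennreal (score z t)"
    by (rule marked_poisson_score)
  have "M.energy 0 \<omega> = ennreal x * total_score \<omega>" for \<omega>
    unfolding M.energy_def using assms
    by (simp add: total_score_def ppr_score_def ennreal_mult ennreal_suminf_cmult)
  then show ?thesis by (simp add: M.J_def ppr_score_def)
qed

lemma index_prob_eq:
  "ppr_index_prob \<alpha> g (fst \<omega>) (snd \<omega>) k
     = (\<integral>\<^sup>+x. ennreal (ppr_score \<alpha> g (fst \<omega>) (snd \<omega>) k) * eexp (ennreal x * total_score \<omega>)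
       * indicator {0<..} x \<partial>lborel)"
proof -
  \<comment> \<open>Each score is at most the total, so a zero total forces a zero score, as
    \<open>nn_integral_eexp_cmult\<close> demands.\<close>
  have "ennreal (ppr_score \<alpha> g (fst \<omega>) (snd \<omega>) k)
    = (\<Sum>i\<in>{k}. ennreal (ppr_score \<alpha> g (fst \<omega>) (snd \<omega>) i))"
    by simp
  also have "\<dots> \<le> total_score \<omega>"
    unfolding total_score_def by (rule sum_le_suminf) auto
  finally show ?thesis
    by (subst nn_integral_eexp_cmult) (auto simp: ppr_index_prob_def total_score_def)
qed

lemma expected_ln_index_eq:
  "(\<integral>\<^sup>+\<omega>. (\<Sum>k. ppr_index_prob \<alpha> g (fst \<omega>) (snd \<omega>) k * ennreal (ln (real (Suc k)))) \<partial>ppr_space Q)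
     = (\<integral>\<^sup>+x. (\<Sum>k. ennreal (ln (real (Suc k))) * J x k 0) * indicator {0<..} x \<partial>lborel)"
proof -
  interpret \<Omega>: prob_space "ppr_space Q" by (rule prob_space_ppr_space) (rule prob_space_axioms)
  interpret P: pair_sigma_finite lborel "ppr_space Q" ..
  let ?f = "\<lambda>x \<omega> k. ennreal (ln (real (Suc k))) * (ennreal (ppr_score \<alpha> g (fst \<omega>) (snd \<omega>) k)
    * eexp (ennreal x * total_score \<omega>)) * indicator {0<..} x"
  have "(\<integral>\<^sup>+\<omega>. (\<Sum>k. ppr_index_prob \<alpha> g (fst \<omega>) (snd \<omega>) k * ennreal (ln (real (Suc k)))) \<partial>ppr_space
    Q)
     = (\<integral>\<^sup>+\<omega>. (\<integral>\<^sup>+x. (\<Sum>k. ?f x \<omega> k) \<partial>lborel) \<partial>ppr_space Q)"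
  proof (intro nn_integral_cong)
    fix \<omega>
    have "(\<integral>\<^sup>+x. (\<Sum>k. ?f x \<omega> k) \<partial>lborel) = (\<Sum>k. \<integral>\<^sup>+x. ?f x \<omega> k \<partial>lborel)"
      by (rule nn_integral_suminf) measurable
    also have "\<dots> = (\<Sum>k. ppr_index_prob \<alpha> g (fst \<omega>) (snd \<omega>) k * ennreal (ln (real (Suc k))))"
      unfolding index_prob_eq mult.assoc
      by (subst nn_integral_cmult) (auto simp: mult_ac)
    finally show "(\<Sum>k. ppr_index_prob \<alpha> g (fst \<omega>) (snd \<omega>) k * ennreal (ln (real (Suc k))))
      = (\<integral>\<^sup>+x. (\<Sum>k. ?f x \<omega> k) \<partial>lborel)" ..
  qed
  also have "\<dots> = (\<integral>\<^sup>+x. (\<integral>\<^sup>+\<omega>. (\<Sum>k. ?f x \<omega> k) \<partial>ppr_space Q) \<partial>lborel)"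
    by (rule P.Fubini') measurable
  also have "\<dots> = (\<integral>\<^sup>+x. (\<Sum>k. ennreal (ln (real (Suc k))) * J x k 0) * indicator {0<..} x \<partial>lborel)"
  proof (intro nn_integral_cong)
    fix x :: real
    show "(\<integral>\<^sup>+\<omega>. (\<Sum>k. ?f x \<omega> k) \<partial>ppr_space Q) = (\<Sum>k. ennreal (ln (real (Suc k))) * J x k 0)
      * indicator {0<..} x"
      by (cases "0 < x") (simp_all add: nn_integral_suminf nn_integral_cmult J_eq del: of_nat_Suc)
  qed
  finally show ?thesis .
qed

text \<open>Instance of \<open>suminf_ln_J_le\<close> in which each point has energy x times its
  score and the selected point is weighted by its score. The limit L is c x^(1/\<alpha>).\<close>

lemma suminf_ln_J_score_le:
  assumes x: "0 < x"
  shows "(\<Sum>k. ennreal (ln (real (Suc k))) * J x k 0)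
     \<le> (\<integral>\<^sup>+v. (\<integral>\<^sup>+z. ennreal (score z v * exp (- (x * score z v)) * exp (- (c * x powr (1 / \<alpha>))))
       * (ennreal (ln (1 + v)) * indicator {0<..} v) \<partial>Q) \<partial>lborel)"
proof -
  interpret M: marked_poisson Q "\<lambda>z t. ennreal (x * score z t)" "\<lambda>z t. ennreal (score z t)"
    by (rule marked_poisson_score)
  obtain \<Phi> where \<Phi>: "\<And>t. DERIV \<Phi> t :> \<phi> x t"
    and L: "(\<lambda>n. real n - (\<Phi> (real n) - \<Phi> 0)) \<longlonglongrightarrow> c * x powr (1 / \<alpha>)"
    using exists_\<Phi>[OF x] by blast
  have wt: "M.wt v = ennreal (\<phi> x v)" if "0 < v" for v
  proof -
    have "M.wt v = (\<integral>\<^sup>+z. ennreal (kern x z v) \<partial>Q)"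
      unfolding M.wt_def using x that by (intro nn_integral_cong) (auto simp: eexp_ennreal kern_def)
    also have "\<dots> = ennreal (\<phi> x v)"
      unfolding \<phi>_def using kern_bounds[OF x]
        by (intro nn_integral_eq_integral integrable_kern x) auto
    finally show ?thesis .
  qed
  have mark: "M.mark v = (\<integral>\<^sup>+z. ennreal (score z v * exp (- (x * score z v))) \<partial>Q)" for v
    unfolding M.mark_def using x
    by (intro nn_integral_cong) (auto simp: eexp_ennreal ennreal_mult'[symmetric])
  have "(\<Sum>k. ennreal (ln (real (Suc k))) * J x k 0)
     \<le> (\<integral>\<^sup>+v. M.mark v * ennreal (ln (1 + v)) * indicator {0<..} v \<partial>lborel) * ennreal (exp (- (c
       * x powr (1 / \<alpha>))))"
    by (rule M.suminf_ln_J_le[OF \<Phi> measurable_\<phi>[OF x] \<phi>_bounds[OF x] wt L])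
  also have "\<dots> = (\<integral>\<^sup>+v. M.mark v * (ennreal (ln (1 + v)) * indicator {0<..} v * ennreal (exp (- (c
    * x powr (1 / \<alpha>))))) \<partial>lborel)"
    by (subst nn_integral_multc[symmetric]) (auto simp: mult_ac)
  also have "\<dots> = (\<integral>\<^sup>+v. (\<integral>\<^sup>+z. ennreal (score z v * exp (- (x * score z v)) * exp (- (c
    * x powr (1 / \<alpha>)))) * (ennreal (ln (1 + v)) * indicator {0<..} v) \<partial>Q) \<partial>lborel)"
    unfolding mark
    by (intro nn_integral_cong, subst nn_integral_multc[symmetric], measurable,
      intro nn_integral_cong) (auto simp: ennreal_mult mult_ac)
  finally show ?thesis .
qed

text \<open>Substitute w = a x with \<open>a\<close> the score. Then x^(1/\<alpha>) becomes
  w^(1/\<alpha>) v / g z, so only the ratio of arrival time and density survives.\<close>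

lemma nn_integral_score_exp:
  assumes gz: "0 < g z" and v: "0 < v"
  shows "(\<integral>\<^sup>+x. ennreal (score z v * exp (- (x * score z v)) * exp (- (c * x powr (1 / \<alpha>))))
    * indicator {0<..} x \<partial>lborel)
       = hdens (v / g z)"
proof -
  define a where "a = score z v"
  have a: "0 < a" using gz v by (simp add: a_def)
  have pw: "(w / a) powr (1 / \<alpha>) = w powr (1 / \<alpha>) * (v / g z)" if "0 < w" for w
    using that gz v \<alpha> by (simp add: a_def powr_divide powr_powr powr_mult)
  have "(\<integral>\<^sup>+x. ennreal (a * exp (- (x * a)) * exp (- (c * x powr (1 / \<alpha>))))
    * indicator {0<..} x \<partial>lborel)
     = ennreal \<bar>1 / a\<bar> * (\<integral>\<^sup>+w. ennreal (a * exp (- ((0 + 1 / a * w) * a)) * exp (- (c * (0 + 1 / a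
       * w) powr (1 / \<alpha>)))) * indicator {0<..} (0 + 1 / a * w) \<partial>lborel)"
    using a by (intro nn_integral_real_affine) auto
  also have "\<dots> = (\<integral>\<^sup>+w. ennreal \<bar>1 / a\<bar> * (ennreal (a * exp (- ((0 + 1 / a * w) * a)) * exp (- (c
    * (0 + 1 / a * w) powr (1 / \<alpha>)))) * indicator {0<..} (0 + 1 / a * w)) \<partial>lborel)"
    by (rule nn_integral_cmult[symmetric]) measurable
  also have "\<dots> = hdens (v / g z)"
    unfolding hdens_def
  proof (intro nn_integral_cong)
    fix w :: real
    show "ennreal \<bar>1 / a\<bar> * (ennreal (a * exp (- ((0 + 1 / a * w) * a)) * exp (- (c * (0 + 1 / a
      * w) powr (1 / \<alpha>)))) * indicator {0<..} (0 + 1 / a * w))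
      = ennreal (exp (- w) * exp (- (c * w powr (1 / \<alpha>) * (v / g z)))) * indicator {0<..} w"
    proof (cases "0 < w")
      case True
      then show ?thesis using a pw[OF True]
        by (simp add: ennreal_mult'[symmetric] mult.assoc)
    next
      case False
      then show ?thesis using a by (simp add: indicator_def zero_less_divide_iff)
    qed
  qed
  finally show ?thesis by (simp add: a_def)
qed

text \<open>Tonelli brings the integral over \<open>x\<close> innermost, where it produces
  \<open>hdens (v / g z)\<close>. The substitution v = g z * s then yields the Jacobian
  \<open>g z\<close>, the density that turns \<open>Q\<close> into \<open>P\<close>.\<close>

lemma expected_ln_index_le:
  "(\<integral>\<^sup>+\<omega>. (\<Sum>k. ppr_index_prob \<alpha> g (fst \<omega>) (snd \<omega>) k * ennreal (ln (real (Suc k)))) \<partial>ppr_space Q)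
     \<le> (\<integral>\<^sup>+z. ennreal (g z) * (\<integral>\<^sup>+s. hdens s * ennreal (ln (1 + g z * s))
       * indicator {0<..} s \<partial>lborel) \<partial>Q)"
proof -
  interpret Ql: pair_sigma_finite Q lborel ..
  let ?F = "\<lambda>x v z. ennreal (score z v * exp (- (x * score z v)) * exp (- (c * x powr (1 / \<alpha>))))
    * (ennreal (ln (1 + v)) * indicator {0<..} v) * indicator {0<..} x"
  have "(\<integral>\<^sup>+\<omega>. (\<Sum>k. ppr_index_prob \<alpha> g (fst \<omega>) (snd \<omega>) k * ennreal (ln (real (Suc k)))) \<partial>ppr_space
    Q)
     \<le> (\<integral>\<^sup>+x. (\<integral>\<^sup>+v. (\<integral>\<^sup>+z. ?F x v z \<partial>Q) \<partial>lborel) \<partial>lborel)"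
    unfolding expected_ln_index_eq
  proof (intro nn_integral_mono)
    fix x :: real
    show "(\<Sum>k. ennreal (ln (real (Suc k))) * J x k 0) * indicator {0<..} x
      \<le> (\<integral>\<^sup>+v. (\<integral>\<^sup>+z. ?F x v z \<partial>Q) \<partial>lborel)"
      using suminf_ln_J_score_le[of x] by (cases "0 < x") auto
  qed
  also have "\<dots> = (\<integral>\<^sup>+x. (\<integral>\<^sup>+z. (\<integral>\<^sup>+v. ?F x v z \<partial>lborel) \<partial>Q) \<partial>lborel)"
    by (intro nn_integral_cong Ql.Fubini') measurable
  also have "\<dots> = (\<integral>\<^sup>+z. (\<integral>\<^sup>+x. (\<integral>\<^sup>+v. ?F x v z \<partial>lborel) \<partial>lborel) \<partial>Q)"
    by (intro Ql.Fubini') measurable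
  also have "\<dots> = (\<integral>\<^sup>+z. (\<integral>\<^sup>+v. (\<integral>\<^sup>+x. ?F x v z \<partial>lborel) \<partial>lborel) \<partial>Q)"
    by (intro nn_integral_cong lborel_pair.Fubini') measurable
  also have "\<dots> = (\<integral>\<^sup>+z. ennreal (g z) * (\<integral>\<^sup>+s. hdens s * ennreal (ln (1 + g z * s))
    * indicator {0<..} s \<partial>lborel) \<partial>Q)"
  proof (intro nn_integral_cong)
    fix z assume [simp]: "z \<in> space Q"
    show "(\<integral>\<^sup>+v. (\<integral>\<^sup>+x. ?F x v z \<partial>lborel) \<partial>lborel) = ennreal (g z) * (\<integral>\<^sup>+s. hdens s * ennreal (ln (1
      + g z * s)) * indicator {0<..} s \<partial>lborel)"
    proof (cases "g z = 0")
      case False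
      then have gz: "0 < g z" using g_nonneg[of z] by simp
      have "(\<integral>\<^sup>+v. (\<integral>\<^sup>+x. ?F x v z \<partial>lborel) \<partial>lborel) = (\<integral>\<^sup>+v. hdens (v / g z) * ennreal (ln (1 + v))
        * indicator {0<..} v \<partial>lborel)"
      proof (intro nn_integral_cong)
        fix v :: real
        have "(\<integral>\<^sup>+x. ?F x v z \<partial>lborel)
            = (\<integral>\<^sup>+x. ennreal (score z v * exp (- (x * score z v)) * exp (- (c * x powr (1 / \<alpha>))))
              * indicator {0<..} x \<partial>lborel) * (ennreal (ln (1 + v)) * indicator {0<..} v)"
          by (subst nn_integral_multc[symmetric]) (auto simp: mult_ac)
        then show "(\<integral>\<^sup>+x. ?F x v z \<partial>lborel) = hdens (v / g z) * ennreal (ln (1 + v))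
          * indicator {0<..} v"
          using nn_integral_score_exp[OF gz, of v] by (cases "0 < v") (auto simp: mult_ac)
      qed
      also have "\<dots> = ennreal \<bar>g z\<bar> * (\<integral>\<^sup>+s. hdens ((0 + g z * s) / g z) * ennreal (ln (1 + (0 + g z
        * s))) * indicator {0<..} (0 + g z * s) \<partial>lborel)"
        using gz by (intro nn_integral_real_affine) auto
      also have "(\<integral>\<^sup>+s. hdens ((0 + g z * s) / g z) * ennreal (ln (1 + (0 + g z * s)))
        * indicator {0<..} (0 + g z * s) \<partial>lborel)
         = (\<integral>\<^sup>+s. hdens s * ennreal (ln (1 + g z * s)) * indicator {0<..} s \<partial>lborel)"
        using gz by (intro nn_integral_cong) (auto simp: indicator_def zero_less_mult_iff)
      finally show ?thesis using gz by simp
    qed simp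
  qed
  finally show ?thesis .
qed

text \<open>The law of \<Theta>. The indicator is essential because \<open>hdens\<close> is positive
  for s \<le> 0 as well.\<close>

definition "hmeas = density lborel (\<lambda>s. hdens s * indicator {0<..} s)"

lemma sets_hmeas[simp, measurable_cong]: "sets hmeas = sets borel"
  by (simp add: hmeas_def)

lemma nn_integral_hmeas:
  "f \<in> borel_measurable borel \<Longrightarrow> (\<integral>\<^sup>+s. f s \<partial>hmeas)
    = (\<integral>\<^sup>+s. hdens s * f s * indicator {0<..} s \<partial>lborel)"
  unfolding hmeas_def by (subst nn_integral_density) (auto simp: mult_ac)

lemma AE_hmeas_pos: "AE s in hmeas. 0 < s"
  unfolding hmeas_def by (subst AE_density) (auto simp: indicator_def)

text \<open>The total mass is the moment of order 0, and \<open>ppr_const \<alpha> 0\<close> is c /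
  c.\<close>

lemma prob_space_hmeas: "prob_space hmeas"
proof
  have "emeasure hmeas (space hmeas) = (\<integral>\<^sup>+s. 1 \<partial>hmeas)" by simp
  also have "\<dots> = (\<integral>\<^sup>+s. hdens s * ennreal (s powr 0) * indicator {0<..} s \<partial>lborel)"
    by (subst nn_integral_hmeas) (auto intro!: nn_integral_cong simp: indicator_def)
  also have "\<dots> = ennreal (ppr_const \<alpha> 0)" using \<alpha> by (intro hdens_moment) auto
  also have "ppr_const \<alpha> 0 = 1" using c_pos by (simp add: ppr_const_def)
  finally show "emeasure hmeas (space hmeas) = 1" by simp
qed

lemma hmeas_moment:
  assumes "0 \<le> \<eta>" "\<eta> < \<alpha> - 1"
  shows "integrable hmeas (\<lambda>s. s powr \<eta>)" "(\<integral>s. s powr \<eta> \<partial>hmeas) = ppr_const \<alpha> \<eta>"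
proof -
  have "(\<integral>\<^sup>+s. ennreal (s powr \<eta>) \<partial>hmeas) = ennreal (ppr_const \<alpha> \<eta>)"
    by (subst nn_integral_hmeas) (simp_all add: hdens_moment[OF assms])
  then show "integrable hmeas (\<lambda>s. s powr \<eta>)" "(\<integral>s. s powr \<eta> \<partial>hmeas) = ppr_const \<alpha> \<eta>"
    using assms \<alpha> by (subst (asm) nn_integral_eq_integrable; simp add: ppr_const_nonneg)+
qed

text \<open>Average the tangent bound over \<Theta> with \<open>A\<close> equal to the mean of 1 +
  \<Theta>^\<eta>, then replace a^(-\<eta>) by its affine bound. The last term of \<open>U\<close>
  has nonpositive mean under \<open>P\<close> once a = g(Z). That \<open>U\<close> is nonnegative
  serves later to pass between \<open>ennreal\<close> and real integrals.\<close>

lemma nn_integral_ln_hmeas_le: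
  assumes \<eta>: "0 < \<eta>" "\<eta> \<le> 1" "\<eta> < \<alpha> - 1" and a: "0 < a"
  defines "A \<equiv> ppr_const \<alpha> \<eta> + 1"
  defines "U \<equiv> ln a + ln A / \<eta> + (1 / a - 1) / A"
  shows "(\<integral>\<^sup>+s. ennreal (ln (1 + a * s)) \<partial>hmeas) \<le> ennreal U" "0 \<le> U"
proof -
  interpret H: prob_space hmeas by (rule prob_space_hmeas)
  define R where "R s = ln a + (ln A + (a powr (- \<eta>) + s powr \<eta>) / A - 1) / \<eta>" for s
  have A: "0 < A" using ppr_const_nonneg[of \<alpha> \<eta>] \<alpha> \<eta> by (simp add: A_def)
  have R_eq: "R s = (ln a + (ln A + a powr (- \<eta>) / A - 1) / \<eta>) + (1 / (A * \<eta>)) * s powr \<eta>" for s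
    using A \<eta> by (simp add: R_def field_simps)
  have int: "integrable hmeas R"
    unfolding R_eq using hmeas_moment(1)[of \<eta>] \<eta>
      by (intro Bochner_Integration.integrable_add integrable_mult_right H.integrable_const) auto
  have R_ge: "AE s in hmeas. ln (1 + a * s) \<le> R s"
    using AE_hmeas_pos
      by eventually_elim (unfold R_def, use \<eta> a A in \<open>intro ln_one_plus_le_tangent\<close>, auto)
  have R_nn: "AE s in hmeas. 0 \<le> R s"
    using AE_hmeas_pos R_ge by eventually_elim (use a in \<open>auto intro: order_trans[rotated]\<close>)
  have "(\<integral>s. R s \<partial>hmeas) = (ln a + (ln A + a powr (- \<eta>) / A - 1) / \<eta>) + (1 / (A * \<eta>))
    * ppr_const \<alpha> \<eta>"
    unfolding R_eq using hmeas_moment[of \<eta>] \<eta>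
      by (subst Bochner_Integration.integral_add) (auto simp: H.prob_space)
  also have "\<dots> \<le> (ln a + (ln A + (\<eta> / a + (1 - \<eta>)) / A - 1) / \<eta>) + (1 / (A * \<eta>)) * ppr_const \<alpha> \<eta>"
    using powr_minus_le_affine[OF a \<eta>(1,2)] A \<eta>
    by (intro add_mono order_refl divide_right_mono diff_mono) auto
  also have "\<dots> = U"
  proof -
    have M: "ppr_const \<alpha> \<eta> = A - 1" by (simp add: A_def)
    show ?thesis unfolding M U_def using A \<eta> a by (simp add: divide_simps) (simp add: algebra_simps)
  qed
  finally have le: "(\<integral>s. R s \<partial>hmeas) \<le> U" .
  have "0 \<le> (\<integral>s. R s \<partial>hmeas)" using R_nn by (rule integral_nonneg_AE)
  with le show "0 \<le> U" by simp
  have "(\<integral>\<^sup>+s. ennreal (ln (1 + a * s)) \<partial>hmeas) \<le> (\<integral>\<^sup>+s. ennreal (R s) \<partial>hmeas)"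
    using R_ge by (intro nn_integral_mono_AE) (auto elim!: eventually_mono intro: ennreal_leI)
  also have "\<dots> = ennreal (\<integral>s. R s \<partial>hmeas)"
    using int R_nn by (rule nn_integral_eq_integral)
  also have "\<dots> \<le> ennreal U" using le by (rule ennreal_leI)
  finally show "(\<integral>\<^sup>+s. ennreal (ln (1 + a * s)) \<partial>hmeas) \<le> ennreal U" .
qed

lemma expected_ln_index_le_KL:
  assumes \<eta>: "0 < \<eta>" "\<eta> \<le> 1" "\<eta> < \<alpha> - 1"
    and P: "P = density Q (\<lambda>z. ennreal (g z))" and int: "integrable P (\<lambda>z. ln (g z))"
  defines "B \<equiv> (\<integral>z. ln (g z) \<partial>P) + ln (ppr_const \<alpha> \<eta> + 1) / \<eta>"
  shows "(\<integral>\<^sup>+\<omega>. (\<Sum>k. ppr_index_prob \<alpha> g (fst \<omega>) (snd \<omega>) k * ennreal (ln (real (Suc k)))) \<partial>ppr_space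
    Q) \<le> ennreal B"
    and "0 \<le> B"
proof -
  define A where "A = ppr_const \<alpha> \<eta> + 1"
  define U where "U z = ln (g z) + ln A / \<eta> + (1 / g z - 1) / A" for z
  have A: "0 < A" using ppr_const_nonneg[of \<alpha> \<eta>] \<alpha> \<eta> by (simp add: A_def)
  have [measurable_cong]: "sets P = sets Q" by (simp add: P)
  interpret P: prob_space P
  proof
    have "emeasure P (space P) = (\<integral>\<^sup>+z. ennreal (g z) * indicator (space Q) z \<partial>Q)"
      unfolding P by (subst emeasure_density) auto
    also have "\<dots> = (\<integral>\<^sup>+z. ennreal (g z) \<partial>Q)" by (intro nn_integral_cong) auto
    finally show "emeasure P (space P) = 1" by (simp add: g_integral)
  qed
  have pos: "AE z in P. 0 < g z"
    unfolding P by (subst AE_density) (auto simp: less_le g_nonneg)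
  \<comment> \<open>Under \<open>Q\<close> the integrand is g * (1 / g), which is 1 where g > 0 and
    0 elsewhere.\<close>
  have inv_le: "(\<integral>\<^sup>+z. ennreal (1 / g z) \<partial>P) \<le> 1"
  proof -
    have "(\<integral>\<^sup>+z. ennreal (1 / g z) \<partial>P) = (\<integral>\<^sup>+z. ennreal (g z) * ennreal (1 / g z) \<partial>Q)"
      unfolding P by (subst nn_integral_density) auto
    also have "\<dots> \<le> (\<integral>\<^sup>+z. 1 \<partial>Q)"
      using g_nonneg by (intro nn_integral_mono) (simp add: ennreal_mult'[symmetric])
    also have "\<dots> = 1" by (simp add: emeasure_space_1)
    finally show ?thesis .
  qed
  have inv_int: "integrable P (\<lambda>z. 1 / g z)"
    using inv_le g_nonneg by (intro integrableI_nonneg) (auto intro: le_less_trans)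
  have inv_integral: "(\<integral>z. 1 / g z \<partial>P) \<le> 1"
    using inv_le g_nonneg nn_integral_eq_integral[OF inv_int] by auto
  have U_int: "integrable P U"
    unfolding U_def using int inv_int by auto
  have U_nn: "AE z in P. 0 \<le> U z"
    using pos by eventually_elim (use nn_integral_ln_hmeas_le(2)[OF \<eta>] in \<open>auto simp: U_def A_def\<close>)
  have "(\<integral>z. U z \<partial>P) = (\<integral>z. ln (g z) \<partial>P) + ln A / \<eta> + ((\<integral>z. 1 / g z \<partial>P) - 1) / A"
    unfolding U_def using int inv_int by (simp add: P.prob_space)
  also have "\<dots> \<le> B" using inv_integral A by (simp add: B_def A_def[symmetric] divide_nonpos_pos)
  finally have le: "(\<integral>z. U z \<partial>P) \<le> B" .
  have "0 \<le> (\<integral>z. U z \<partial>P)" using U_nn by (rule integral_nonneg_AE)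
  with le show "0 \<le> B" by simp
  have "(\<integral>\<^sup>+\<omega>. (\<Sum>k. ppr_index_prob \<alpha> g (fst \<omega>) (snd \<omega>) k * ennreal (ln (real (Suc k)))) \<partial>ppr_space
    Q)
     \<le> (\<integral>\<^sup>+z. ennreal (g z) * (\<integral>\<^sup>+s. hdens s * ennreal (ln (1 + g z * s))
       * indicator {0<..} s \<partial>lborel) \<partial>Q)"
    by (rule expected_ln_index_le)
  also have "\<dots> \<le> (\<integral>\<^sup>+z. ennreal (g z) * ennreal (U z) \<partial>Q)"
  proof (intro nn_integral_mono)
    fix z
    show "ennreal (g z) * (\<integral>\<^sup>+s. hdens s * ennreal (ln (1 + g z * s)) * indicator {0<..} s \<partial>lborel)
      \<le> ennreal (g z) * ennreal (U z)"
    proof (cases "g z = 0")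
      case False
      then have "0 < g z" using g_nonneg[of z] by simp
      from nn_integral_ln_hmeas_le(1)[OF \<eta> this] show ?thesis
        by (intro mult_left_mono) (simp_all add: nn_integral_hmeas U_def A_def)
    qed simp
  qed
  also have "\<dots> = (\<integral>\<^sup>+z. ennreal (U z) \<partial>P)"
    unfolding P by (subst nn_integral_density) (auto simp: U_def)
  also have "\<dots> = ennreal (\<integral>z. U z \<partial>P)"
    using U_int U_nn by (rule nn_integral_eq_integral)
  also have "\<dots> \<le> ennreal B" using le by (rule ennreal_leI)
  finally show "(\<integral>\<^sup>+\<omega>. (\<Sum>k. ppr_index_prob \<alpha> g (fst \<omega>) (snd \<omega>) k
    * ennreal (ln (real (Suc k)))) \<partial>ppr_space Q) \<le> ennreal B" .
qed

end

section \<open>The Radon-Nikodym derivative, the base of the logarithm and the infimum\<close>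

lemma density_enn2real_RN_deriv:
  assumes "prob_space P" "prob_space Q" "sets P = sets Q" "absolutely_continuous Q P"
  shows "density Q (\<lambda>z. ennreal (enn2real (RN_deriv Q P z))) = P"
proof -
  interpret P: prob_space P by fact
  interpret Q: prob_space Q by fact
  have "AE z in Q. RN_deriv Q P z \<noteq> \<infinity>"
    using assms by (intro Q.RN_deriv_finite) (auto intro: P.sigma_finite_measure_axioms)
  then have "density Q (\<lambda>z. ennreal (enn2real (RN_deriv Q P z))) = density Q (RN_deriv Q P)"
    by (intro density_cong) (auto elim!: eventually_mono simp: less_top)
  also have "\<dots> = P" using assms by (intro Q.density_RN_deriv) auto
  finally show ?thesis .
qed

text \<open>Take \<open>g\<close> to be the real-valued Radon-Nikodym derivative and divide the
  bound in natural logarithms by \<open>ln b\<close>.\<close>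

lemma ppr_expected_log_index_le:
  fixes P Q :: "'a measure" and \<alpha> b \<eta> :: real
  assumes b: "1 < b" and \<alpha>: "1 < \<alpha>"
    and PQ: "prob_space P" "prob_space Q" "sets P = sets Q" "absolutely_continuous Q P"
    and int: "integrable P (entropy_density b Q P)"
    and \<eta>: "0 < \<eta>" "\<eta> \<le> 1" "\<eta> < \<alpha> - 1"
  shows "enn2ereal (ppr_expected_log_index b \<alpha> P Q) \<le> ereal (KL_divergence b Q P + (1 / \<eta>) * log b (ppr_const \<alpha> \<eta> + 1))"
proof -
  define g where "g z = enn2real (RN_deriv Q P z)" for z
  interpret P: prob_space P by fact
  interpret Q: prob_space Q by fact
  have [measurable]: "g \<in> borel_measurable Q" unfolding g_def[abs_def] by measurable
  have P: "P = density Q (\<lambda>z. ennreal (g z))"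
    using density_enn2real_RN_deriv[OF PQ] by (simp add: g_def)
  interpret ppr_target Q g \<alpha>
  proof
    have "1 = emeasure P (space P)" by (simp add: P.emeasure_space_1)
    also have "\<dots> = (\<integral>\<^sup>+z. ennreal (g z) * indicator (space Q) z \<partial>Q)"
      unfolding P by (subst emeasure_density) auto
    also have "\<dots> = (\<integral>\<^sup>+z. ennreal (g z) \<partial>Q)" by (intro nn_integral_cong) auto
    finally show "(\<integral>\<^sup>+z. ennreal (g z) \<partial>Q) = 1" ..
  qed (use \<alpha> in \<open>auto simp: g_def\<close>)
  have lb: "0 < ln b" using b by simp
  have ed: "entropy_density b Q P = (\<lambda>z. ln (g z) / ln b)"
    by (simp add: entropy_density_def g_def fun_eq_iff log_def)
  have int': "integrable P (\<lambda>z. ln (g z))"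
    using integrable_mult_right[OF int[unfolded ed], of "ln b"] lb by simp
  define B where "B = (\<integral>z. ln (g z) \<partial>P) + ln (ppr_const \<alpha> \<eta> + 1) / \<eta>"
  note bound = expected_ln_index_le_KL[OF \<eta> P int', folded B_def]
  have "ppr_expected_log_index b \<alpha> P Q
     = (\<integral>\<^sup>+\<omega>. ennreal (1 / ln b) * (\<Sum>k. ppr_index_prob \<alpha> g (fst \<omega>) (snd \<omega>) k
       * ennreal (ln (real (Suc k)))) \<partial>ppr_space Q)"
    unfolding ppr_expected_log_index_def g_def[symmetric] ennreal_suminf_cmult[symmetric]
    using lb by (intro nn_integral_cong suminf_cong)
      (simp add: log_def ennreal_mult'[symmetric] mult.left_commute[of "ennreal (1 / ln b)"] del:
        of_nat_Suc)
  also have "\<dots> = ennreal (1 / ln b) * (\<integral>\<^sup>+\<omega>. (\<Sum>k. ppr_index_prob \<alpha> g (fst \<omega>) (snd \<omega>) k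
    * ennreal (ln (real (Suc k)))) \<partial>ppr_space Q)"
    unfolding ppr_index_prob_def by (rule nn_integral_cmult) measurable
  also have "\<dots> \<le> ennreal (1 / ln b) * ennreal B"
    by (intro mult_left_mono bound(1)) auto
  also have "\<dots> = ennreal (B / ln b)"
    using lb bound(2) by (simp add: ennreal_mult'[symmetric])
  finally have "enn2ereal (ppr_expected_log_index b \<alpha> P Q) \<le> enn2ereal (ennreal (B / ln b))"
    by (simp add: less_eq_ennreal.rep_eq)
  also have "\<dots> = ereal (B / ln b)" using lb bound(2) by (simp add: enn2ereal_ennreal)
  also have "B / ln b = KL_divergence b Q P + (1 / \<eta>) * log b (ppr_const \<alpha> \<eta> + 1)"
    by (simp add: B_def KL_divergence_def ed log_def add_divide_distrib)
  finally show ?thesis .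
qed

theorem mainTheorem3:
  fixes P Q :: "'a measure" and \<alpha> b :: real
  assumes "1 < b" and "1 < \<alpha>"
    and "prob_space P" and "prob_space Q" and "sets P = sets Q"
    and "absolutely_continuous Q P"
  shows "enn2ereal (ppr_expected_log_index b \<alpha> P Q)
           \<le> kl_div b P Q + ereal (INF \<eta>\<in>{\<eta>::real. 0 < \<eta> \<and> \<eta> \<le> 1 \<and> \<eta> < \<alpha> - 1}.
                (1 / \<eta>) * log b (Gamma (1 - (\<eta> + 1) / \<alpha>) * Gamma (\<eta> + 1)
                                   / Gamma (1 - 1 / \<alpha>) powr (\<eta> + 1) + 1))
       \<and> kl_div b P Q + ereal (INF \<eta>\<in>{\<eta>::real. 0 < \<eta> \<and> \<eta> \<le> 1 \<and> \<eta> < \<alpha> - 1}.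
                (1 / \<eta>) * log b (Gamma (1 - (\<eta> + 1) / \<alpha>) * Gamma (\<eta> + 1)
                                   / Gamma (1 - 1 / \<alpha>) powr (\<eta> + 1) + 1))
           \<le> kl_div b P Q + ereal (log b 3.56 / min ((\<alpha> - 1) / 2) 1)"
proof -
  define S where "S = {\<eta>::real. 0 < \<eta> \<and> \<eta> \<le> 1 \<and> \<eta> < \<alpha> - 1}"
  define f where "f \<eta> = (1 / \<eta>) * log b (ppr_const \<alpha> \<eta> + 1)" for \<eta>
  \<comment> \<open>Halving \<alpha> - 1 ensures the strict inequality \<eta> < \<alpha> - 1. This
    witness shows that \<open>S\<close> is nonempty and yields the explicit bound.\<close>
  define \<eta>\<^sub>0 where "\<eta>\<^sub>0 = min ((\<alpha> - 1) / 2) 1"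
  have \<eta>\<^sub>0: "\<eta>\<^sub>0 \<in> S" using assms(2) by (auto simp: S_def \<eta>\<^sub>0_def min_def)
  have f_nn: "0 \<le> f \<eta>" if "\<eta> \<in> S" for \<eta>
    using that assms(1,2) ppr_const_nonneg[of \<alpha> \<eta>] by (auto simp: f_def S_def)
  have "enn2ereal (ppr_expected_log_index b \<alpha> P Q) \<le> kl_div b P Q + ereal (INF \<eta>\<in>S. f \<eta>)"
  \<comment> \<open>Without integrability \<open>kl_div\<close> is infinite and the bound is
    trivial.\<close>
  proof (cases "integrable P (entropy_density b Q P)")
    case True
    have le: "enn2ereal (ppr_expected_log_index b \<alpha> P Q) \<le> ereal (KL_divergence b Q P + f \<eta>)"
      if "\<eta> \<in> S" for \<eta>
      using ppr_expected_log_index_le[OF assms True, of \<eta>] that by (simp add: f_def S_def)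
    \<comment> \<open>The expectation is nonnegative and has a finite bound at one admissible
      \<eta>. Being finite, it can be compared with the infimum in the reals after subtracting the
      divergence.\<close>
    obtain e where e: "enn2ereal (ppr_expected_log_index b \<alpha> P Q) = ereal e"
      using le[OF \<eta>\<^sub>0] enn2ereal_nonneg[of "ppr_expected_log_index b \<alpha> P Q"]
      by (cases "enn2ereal (ppr_expected_log_index b \<alpha> P Q)") auto
    have "e - KL_divergence b Q P \<le> (INF \<eta>\<in>S. f \<eta>)"
      using \<eta>\<^sub>0 le e by (intro cINF_greatest) (auto simp: algebra_simps)
    then show ?thesis using True by (simp add: kl_div_def e)
  qed (simp add: kl_div_def)
  moreover have "(INF \<eta>\<in>S. f \<eta>) \<le> log b 3.56 / \<eta>\<^sub>0"
  proof -
    have "(INF \<eta>\<in>S. f \<eta>) \<le> f \<eta>\<^sub>0"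
      using \<eta>\<^sub>0 f_nn by (intro cINF_lower bdd_belowI2[where m=0]) auto
    also have "\<dots> = log b (ppr_const \<alpha> \<eta>\<^sub>0 + 1) / \<eta>\<^sub>0" by (simp add: f_def)
    also have "\<dots> \<le> log b 3.56 / \<eta>\<^sub>0"
      using \<eta>\<^sub>0 assms(1,2) ppr_const_le[of \<alpha>] ppr_const_nonneg[of \<alpha> \<eta>\<^sub>0]
      by (intro divide_right_mono log_mono) (auto simp: \<eta>\<^sub>0_def[symmetric] S_def)
    finally show ?thesis .
  qed
  then have "kl_div b P Q + ereal (INF \<eta>\<in>S. f \<eta>) \<le> kl_div b P Q + ereal (log b 3.56 / \<eta>\<^sub>0)"
    by (intro add_left_mono) simp
  ultimately show ?thesis unfolding S_def f_def \<eta>\<^sub>0_def ppr_const_def by blast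
qed

end
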